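(* For a MIMO interference network with configuration $\chi=\{(M_1,N_1,d_1),\dots,(M_K,N_K,d_K)\}$, if the matrix $\mathbf{H}_{\mathrm{all}}$ has full row rank, then the interference alignment (IA) problem has a solution almost surely. (That is, the event that $\mathbf{H}_{\mathrm{all}}$ has full row rank while the IA problem has no solution has probability zero.)
   Context: A MIMO interference network has $K$ transmitter-receiver pairs; transmitter $k$ has $M_k$ antennas, receiver $k$ has $N_k$ antennas, and $d_k$ data streams are sent from transmitter $k$ to receiver $k$ ($M_k,N_k,d_k$ positive integers). It is assumed that $d_k\le\min\{M_k,N_k\}$ for all $k$. The channel matrices are $\mathbf{H}_{kj}\in\mathbb{C}^{N_k\times M_j}$, $k,j\in\{1,\dots,K\}$, and $h_{kj}(p,q)$ denotes the $(p,q)$ entry of $\mathbf{H}_{kj}$; the entries of all the channel matrices are independent random variables drawn from continuous distributions. IA problem: given $\{\mathbf{H}_{kj}\}$, find $\mathbf{U}_k\in\mathbb{C}^{N_k\times d_k}$ and $\mathbf{V}_k\in\mathbb{C}^{M_k\times d_k}$, $k\in\{1,\dots,K\}$, such that $\mathrm{rank}(\mathbf{U}_k^H\mathbf{H}_{kk}\mathbf{V}_k)=d_k$ for all $k$, and $\mathbf{U}_k^H\mathbf{H}_{kj}\mathbf{V}_j=\mathbf{0}$ for all $k\ne j$. Here $(\cdot)^H$ is the Hermitian transpose. The matrix $\mathbf{H}_{\mathrm{all}}$ has $C=\sum_{k}\sum_{j\ne k}d_kd_j$ rows and $\sum_{k}d_k(M_k+N_k-2d_k)$ columns. Its rows are indexed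 (lexicographically) by $(k,j,p,q)$ with $k\ne j$ in $\{1,\dots,K\}$, $p\in\{1,\dots,d_k\}$, $q\in\{1,\dots,d_j\}$. Its columns consist of a first group indexed by $(k',p',n)$ with $k'\in\{1,\dots,K\}$, $p'\in\{1,\dots,d_{k'}\}$, $n\in\{1,\dots,N_{k'}-d_{k'}\}$, followed by a second group indexed by $(j',q',m)$ with $j'\in\{1,\dots,K\}$, $q'\in\{1,\dots,d_{j'}\}$, $m\in\{1,\dots,M_{j'}-d_{j'}\}$ (each group ordered lexicographically). In row $(k,j,p,q)$, the entry in column $(k',p',n)$ of the first group is $h_{kj}(d_k+n,q)$ if $k'=k$ and $p'=p$, and $0$ otherwise; the entry in column $(j',q',m)$ of the second group is $h_{kj}(p,d_j+m)$ if $j'=j$ and $q'=q$, and $0$ otherwise. Equivalently, the rows are the coefficient vectors of the linear terms of the polynomials obtained from $\mathbf{U}_k^H\mathbf{H}_{kj}\mathbf{V}_j=\mathbf{0}$ after normalizing the top $d_k\times d_k$ block of $\mathbf{U}_k$ and the top $d_j\times d_j$ block of $\mathbf{V}_j$ to identity matrices. *)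

theory Defs
  imports
    "HOL-Probability.Probability"
    "Jordan_Normal_Form.DL_Rank"
    "Jordan_Normal_Form.Schur_Decomposition"
begin

text \<open>
  Users, antennas and streams are numbered from \<open>0\<close>: a configuration consists of the number \<open>K\<close>
  of users and functions \<open>M\<close>, \<open>N\<close>, \<open>d\<close> of which only the values below \<open>K\<close> matter.
  The family of channel matrices is \<open>H k j\<close> (receiver \<open>k\<close>, transmitter \<open>j\<close>).
\<close>

definition mat_rank :: "complex mat \<Rightarrow> nat" where
  "mat_rank A = vec_space.rank (dim_row A) A"

definition full_row_rank :: "complex mat \<Rightarrow> bool" where
  "full_row_rank A \<longleftrightarrow> mat_rank A = dim_row A"

definition IA_solution ::
  "nat \<Rightarrow> (nat \<Rightarrow> nat) \<Rightarrow> (nat \<Rightarrow> nat) \<Rightarrow> (nat \<Rightarrow> nat) \<Rightarrow> (nat \<Rightarrow> nat \<Rightarrow> complex mat)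
    \<Rightarrow> (nat \<Rightarrow> complex mat) \<Rightarrow> (nat \<Rightarrow> complex mat) \<Rightarrow> bool" where
  "IA_solution K M N d H U V \<longleftrightarrow>
     (\<forall>k<K. U k \<in> carrier_mat (N k) (d k) \<and> V k \<in> carrier_mat (M k) (d k)) \<and>
     (\<forall>k<K. mat_rank (mat_adjoint (U k) * H k k * V k) = d k) \<and>
     (\<forall>k<K. \<forall>j<K. k \<noteq> j \<longrightarrow> mat_adjoint (U k) * H k j * V j = 0\<^sub>m (d k) (d j))"

definition IA_solvable ::
  "nat \<Rightarrow> (nat \<Rightarrow> nat) \<Rightarrow> (nat \<Rightarrow> nat) \<Rightarrow> (nat \<Rightarrow> nat) \<Rightarrow> (nat \<Rightarrow> nat \<Rightarrow> complex mat) \<Rightarrow> bool" where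
  "IA_solvable K M N d H \<longleftrightarrow> (\<exists>U V. IA_solution K M N d H U V)"

definition H_all_rows :: "nat \<Rightarrow> (nat \<Rightarrow> nat) \<Rightarrow> (nat \<times> nat \<times> nat \<times> nat) list" where
  "H_all_rows K d =
     [(k, j, p, q). k \<leftarrow> [0..<K], j \<leftarrow> [0..<K], k \<noteq> j, p \<leftarrow> [0..<d k], q \<leftarrow> [0..<d j]]"

text \<open>\<open>Inl\<close> marks the columns of the first group (unknowns of the receive filters \<open>U\<close>),
  \<open>Inr\<close> those of the second group (unknowns of the precoders \<open>V\<close>).\<close>

definition H_all_cols ::
  "nat \<Rightarrow> (nat \<Rightarrow> nat) \<Rightarrow> (nat \<Rightarrow> nat) \<Rightarrow> (nat \<Rightarrow> nat)
    \<Rightarrow> ((nat \<times> nat \<times> nat) + (nat \<times> nat \<times> nat)) list" where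
  "H_all_cols K M N d =
     [Inl (k', p', n). k' \<leftarrow> [0..<K], p' \<leftarrow> [0..<d k'], n \<leftarrow> [0..<N k' - d k']] @
     [Inr (j', q', m). j' \<leftarrow> [0..<K], q' \<leftarrow> [0..<d j'], m \<leftarrow> [0..<M j' - d j']]"

definition H_all_entry ::
  "(nat \<Rightarrow> nat) \<Rightarrow> (nat \<Rightarrow> nat \<Rightarrow> complex mat)
    \<Rightarrow> nat \<times> nat \<times> nat \<times> nat \<Rightarrow> (nat \<times> nat \<times> nat) + (nat \<times> nat \<times> nat) \<Rightarrow> complex" where
  "H_all_entry d H = (\<lambda>(k, j, p, q) c. case c of
       Inl (k', p', n) \<Rightarrow> if k' = k \<and> p' = p then H k j $$ (d k + n, q) else 0
     | Inr (j', q', m) \<Rightarrow> if j' = j \<and> q' = q then H k j $$ (p, d j + m) else 0)"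

definition H_all ::
  "nat \<Rightarrow> (nat \<Rightarrow> nat) \<Rightarrow> (nat \<Rightarrow> nat) \<Rightarrow> (nat \<Rightarrow> nat) \<Rightarrow> (nat \<Rightarrow> nat \<Rightarrow> complex mat) \<Rightarrow> complex mat"
  where
  "H_all K M N d H =
     mat (length (H_all_rows K d)) (length (H_all_cols K M N d))
       (\<lambda>(r, c). H_all_entry d H (H_all_rows K d ! r) (H_all_cols K M N d ! c))"

lemma length_H_all_rows:
  "length (H_all_rows K d) = (\<Sum>k<K. \<Sum>j\<in>{..<K} - {k}. d k * d j)"
proof -
  have "(\<Sum>j\<leftarrow>[0..<K]. if k \<noteq> j then d k * d j else 0) = (\<Sum>j\<in>{..<K} - {k}. d k * d j)" for k
    by (auto simp: interv_sum_list_conv_sum_set_nat atLeast0LessThan intro!: sum.mono_neutral_cong_right split: if_splits)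
  then show ?thesis
    by (simp add: H_all_rows_def length_concat comp_def if_distrib[of length] sum_list_triv
        interv_sum_list_conv_sum_set_nat atLeast0LessThan cong: if_cong)
qed

lemma length_H_all_cols:
  assumes "\<And>k. k < K \<Longrightarrow> d k \<le> M k \<and> d k \<le> N k"
  shows "length (H_all_cols K M N d) = (\<Sum>k<K. d k * (M k + N k - 2 * d k))"
proof -
  have "d k * (N k - d k) + d k * (M k - d k) = d k * (M k + N k - 2 * d k)" if "k < K" for k
  proof -
    have "(N k - d k) + (M k - d k) = M k + N k - 2 * d k" using assms[OF that] by simp
    then show ?thesis by (metis distrib_left)
  qed
  then show ?thesis
    by (simp add: H_all_cols_def length_concat comp_def sum_list_triv
        interv_sum_list_conv_sum_set_nat atLeast0LessThan flip: sum.distrib)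
qed

text \<open>A continuous distribution is one without atoms. This covers in particular every distribution
  with a density with respect to Lebesgue measure on the complex plane.\<close>

definition continuous_distribution :: "complex measure \<Rightarrow> bool" where
  "continuous_distribution D \<longleftrightarrow> (\<forall>z. measure D {z} = 0)"

end

theory Submission
  imports Defs
begin

text \<open>
  A continuous distribution may be singular, so the exceptional set has to be algebraic: by Fubini, a
  nonzero polynomial in independent atomless variables is almost surely nonzero, and it suffices to
  find a nonzero polynomial \<open>R\<close> in the channel entries such that \<open>R(H) \<noteq> 0\<close> implies solvability.
  With the top blocks of the filters normalised to the identity, alignment reads
  \<open>h = - (L + Q)(x)\<close>, where \<open>h\<close> are the entries \<open>h\<^sub>k\<^sub>j(p, q)\<close> of the top blocks,
  \<open>L\<close> is linear in the unknowns \<open>x\<close> with matrix \<open>H_all\<close>, and \<open>Q\<close> is quadratic; the coefficients of \<open>L\<close> and \<open>Q\<close> are channel entries other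
  than \<open>h\<close>. If \<open>L\<close> is onto for one channel, no nonzero polynomial vanishes on the image of
  \<open>x \<mapsto> - (L + Q)(x)\<close> (compare lowest degree terms), so the polynomial ring in the channel entries
  embeds into the polynomial ring in \<open>x\<close> and the coefficients. By Chevalley's extension lemma a
  generic channel, seen as a homomorphism from the small ring to the complex numbers, extends to the
  large ring, the values of the coordinates \<open>x\<close> being the solution. The extension can be chosen
  nonzero on the product of the \<open>det (U\<^sub>k\<^sup>H H\<^sub>k\<^sub>k V\<^sub>k)\<close>, which gives the rank condition.
\<close>

section \<open>Chevalley's extension lemma\<close>

text \<open>Subrings are subsets of one ambient ring, so that a whole tower of extensions lives in a
  single type. Closure under differences yields zero, negatives and sums.\<close>

definition subring_set :: "'a::comm_ring_1 set \<Rightarrow> bool" where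
  "subring_set A \<longleftrightarrow> 1 \<in> A \<and> (\<forall>a\<in>A. \<forall>b\<in>A. a - b \<in> A \<and> a * b \<in> A)"

lemma subring_set_1: "subring_set A \<Longrightarrow> 1 \<in> A"
  and subring_set_diff: "subring_set A \<Longrightarrow> a \<in> A \<Longrightarrow> b \<in> A \<Longrightarrow> a - b \<in> A"
  and subring_set_mult: "subring_set A \<Longrightarrow> a \<in> A \<Longrightarrow> b \<in> A \<Longrightarrow> a * b \<in> A"
  by (auto simp: subring_set_def)

lemma subring_set_0: "subring_set A \<Longrightarrow> 0 \<in> A"
  using subring_set_diff[OF _ subring_set_1 subring_set_1] by force

lemma subring_set_uminus: "subring_set A \<Longrightarrow> a \<in> A \<Longrightarrow> - a \<in> A"
  using subring_set_diff[OF _ subring_set_0] by force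

lemma subring_set_add: "subring_set A \<Longrightarrow> a \<in> A \<Longrightarrow> b \<in> A \<Longrightarrow> a + b \<in> A"
  using subring_set_diff[OF _ _ subring_set_uminus, of A a b] by force

lemma subring_set_sum: "subring_set A \<Longrightarrow> (\<And>i. i \<in> S \<Longrightarrow> f i \<in> A) \<Longrightarrow> sum f S \<in> A"
  by (induction S rule: infinite_finite_induct) (auto intro: subring_set_0 subring_set_add)

lemma subring_set_power: "subring_set A \<Longrightarrow> a \<in> A \<Longrightarrow> a ^ n \<in> A"
  by (induction n) (auto intro: subring_set_1 subring_set_mult)

text \<open>The map is total, but only its values on \<open>A\<close> are constrained, so extending
  it means agreeing with it on \<open>A\<close>.\<close>

definition hom_on :: "'a::comm_ring_1 set \<Rightarrow> ('a \<Rightarrow> 'k::comm_ring_1) \<Rightarrow> bool" where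
  "hom_on A \<phi> \<longleftrightarrow> \<phi> 1 = 1 \<and> (\<forall>a\<in>A. \<forall>b\<in>A. \<phi> (a + b) = \<phi> a + \<phi> b \<and> \<phi> (a * b) = \<phi> a * \<phi> b)"

lemma hom_on_1: "hom_on A \<phi> \<Longrightarrow> \<phi> 1 = 1"
  and hom_on_add: "hom_on A \<phi> \<Longrightarrow> a \<in> A \<Longrightarrow> b \<in> A \<Longrightarrow> \<phi> (a + b) = \<phi> a + \<phi> b"
  and hom_on_mult: "hom_on A \<phi> \<Longrightarrow> a \<in> A \<Longrightarrow> b \<in> A \<Longrightarrow> \<phi> (a * b) = \<phi> a * \<phi> b"
  by (auto simp: hom_on_def)

lemma hom_on_0: assumes "subring_set A" "hom_on A \<phi>" shows "\<phi> 0 = 0"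
  using hom_on_add[OF assms(2) subring_set_0 subring_set_0] assms(1) by simp

lemma hom_on_diff:
  assumes "subring_set A" "hom_on A \<phi>" "a \<in> A" "b \<in> A" shows "\<phi> (a - b) = \<phi> a - \<phi> b"
  using hom_on_add[OF assms(2) subring_set_diff[OF assms(1,3,4)] assms(4)] by simp

lemma hom_on_sum:
  assumes "subring_set A" "hom_on A \<phi>" "\<And>i. i \<in> S \<Longrightarrow> f i \<in> A"
  shows "\<phi> (sum f S) = (\<Sum>i\<in>S. \<phi> (f i))"
  using assms(3)
proof (induction S rule: infinite_finite_induct)
  case (insert x F)
  then show ?case by (simp add: hom_on_add[OF assms(2)] subring_set_sum[OF assms(1)])
qed (simp_all add: hom_on_0[OF assms(1,2)])

section \<open>Polynomials over a subring and simple ring extensions\<close>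

definition polys_over :: "'a::comm_ring_1 set \<Rightarrow> 'a poly set" where
  "polys_over A = {p. \<forall>i. coeff p i \<in> A}"

lemma coeff_in: "p \<in> polys_over A \<Longrightarrow> coeff p i \<in> A"
  by (simp add: polys_over_def)

lemma subring_polys_over: assumes "subring_set A" shows "subring_set (polys_over A)"
  unfolding subring_set_def[of "polys_over A"]
  using assms by (auto simp: polys_over_def coeff_mult coeff_1 intro!: subring_set_diff subring_set_sum subring_set_mult
      subring_set_0 subring_set_1)

lemma monom_polys_over: "subring_set A \<Longrightarrow> a \<in> A \<Longrightarrow> monom a n \<in> polys_over A"
  by (auto simp: polys_over_def intro: subring_set_0)

lemma hom_on_map_poly:
  assumes "subring_set A" "hom_on A \<phi>" shows "hom_on (polys_over A) (map_poly \<phi>)"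
proof -
  have z: "\<phi> 0 = 0" using hom_on_0 assms by blast
  have "map_poly \<phi> (p + q) = map_poly \<phi> p + map_poly \<phi> q"
    "map_poly \<phi> (p * q) = map_poly \<phi> p * map_poly \<phi> q"
    if "p \<in> polys_over A" "q \<in> polys_over A" for p q
    using that assms
    by (auto intro!: poly_eqI simp: coeff_map_poly z coeff_mult hom_on_add[OF assms(2)] coeff_in
        hom_on_sum[OF assms] hom_on_mult[OF assms(2)] subring_set_mult)
  moreover have "map_poly \<phi> 1 = 1" using hom_on_1[OF assms(2)] by simp
  ultimately show ?thesis by (auto simp: hom_on_def)
qed

definition adjoin :: "'a::comm_ring_1 set \<Rightarrow> 'a \<Rightarrow> 'a set" where
  "adjoin A x = (\<lambda>p. poly p x) ` polys_over A"

lemma subring_adjoin: assumes "subring_set A" shows "subring_set (adjoin A x)"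
proof -
  note P = subring_polys_over[OF assms]
  have "poly p x - poly q x \<in> adjoin A x" "poly p x * poly q x \<in> adjoin A x"
    if "p \<in> polys_over A" "q \<in> polys_over A" for p q
    using subring_set_diff[OF P that] subring_set_mult[OF P that]
    by (auto simp: adjoin_def simp flip: poly_diff poly_mult)
  moreover have "1 \<in> adjoin A x"
    using subring_set_1[OF P] unfolding adjoin_def by (metis image_eqI poly_1)
  ultimately show ?thesis unfolding subring_set_def by (auto simp: adjoin_def)
qed

lemma subset_adjoin: assumes "subring_set A" shows "A \<subseteq> adjoin A x"
proof
  fix a assume "a \<in> A"
  then show "a \<in> adjoin A x"
    using monom_polys_over[OF assms, of a 0] unfolding adjoin_def
    by (auto simp: monom_0 intro!: image_eqI[of _ _ "[:a:]"])
qed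

lemma mem_adjoin: assumes "subring_set A" shows "x \<in> adjoin A x"
  using monom_polys_over[OF assms subring_set_1[OF assms], of 1]
  unfolding adjoin_def by (auto simp: poly_monom intro!: image_eqI[of _ _ "monom 1 1"])

text \<open>\<open>A[x]\<close> is the polynomial ring over \<open>A\<close> modulo the relations of
  \<open>x\<close>. If \<xi> satisfies the images of all these relations, sending \<open>x\<close>
  to \<xi> does not depend on the polynomial chosen to represent an element.\<close>

lemma hom_on_adjoin:
  assumes A: "subring_set A" and \<phi>: "hom_on A \<phi>"
    and zero: "\<And>p. p \<in> polys_over A \<Longrightarrow> poly p x = 0 \<Longrightarrow> poly (map_poly \<phi> p) \<xi> = 0"
  obtains \<psi> where "hom_on (adjoin A x) \<psi>"
    "\<And>p. p \<in> polys_over A \<Longrightarrow> \<psi> (poly p x) = poly (map_poly \<phi> p) \<xi>"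
proof -
  note P = subring_polys_over[OF A] and h = hom_on_map_poly[OF A \<phi>]
  define \<psi> where "\<psi> b = poly (map_poly \<phi> (SOME p. p \<in> polys_over A \<and> poly p x = b)) \<xi>" for b
  have \<psi>: "\<psi> (poly p x) = poly (map_poly \<phi> p) \<xi>" if "p \<in> polys_over A" for p
  proof -
    define q where "q = (SOME q. q \<in> polys_over A \<and> poly q x = poly p x)"
    have q: "q \<in> polys_over A \<and> poly q x = poly p x"
      unfolding q_def by (rule someI[of _ p]) (use that in simp)
    have "poly (map_poly \<phi> (q - p)) \<xi> = 0"
      using q that by (intro zero subring_set_diff P) auto
    then show ?thesis using q that by (simp add: hom_on_diff[OF P h] \<psi>_def flip: q_def)
  qed
  have "hom_on (adjoin A x) \<psi>"
    unfolding hom_on_def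
  proof (intro conjI ballI)
    show "\<psi> 1 = 1" using \<psi>[OF subring_set_1[OF P]] hom_on_1[OF h] by simp
  next
    fix a b assume "a \<in> adjoin A x" "b \<in> adjoin A x"
    then obtain p q where pq: "p \<in> polys_over A" "q \<in> polys_over A" "a = poly p x" "b = poly q x"
      by (auto simp: adjoin_def)
    show "\<psi> (a + b) = \<psi> a + \<psi> b" "\<psi> (a * b) = \<psi> a * \<psi> b"
      using \<psi>[OF subring_set_add[OF P pq(1,2)]] \<psi>[OF subring_set_mult[OF P pq(1,2)]]
      by (simp_all add: pq \<psi> hom_on_add[OF h] hom_on_mult[OF h])
  qed
  with \<psi> that show ?thesis by blast
qed

section \<open>Pseudo-division and minimal relations over a subring\<close>

lemma degree_cancel_lead:
  fixes f g :: "'a::idom poly"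
  assumes "g \<noteq> 0" "degree g \<le> degree f" "degree f > 0"
  shows "degree (Polynomial.smult (lead_coeff g) f - monom (lead_coeff f) (degree f - degree g) * g) < degree f"
proof -
  have "f \<noteq> 0" using assms by auto
  let ?h = "Polynomial.smult (lead_coeff g) f - monom (lead_coeff f) (degree f - degree g) * g"
  have "degree ?h \<le> degree f"
    using assms by (intro degree_diff_le order.trans[OF degree_smult_le] order.trans[OF degree_mult_le])
      (auto simp: degree_monom_eq \<open>f \<noteq> 0\<close>)
  moreover have "coeff ?h (degree f) = 0"
    using assms by (simp add: coeff_monom_mult)
  \<comment> \<open>Positivity of \<open>degree f\<close> makes the drop strict even if the
    difference is the zero polynomial, whose degree counts as 0.\<close>
  ultimately show ?thesis using assms(3)
    by (metis \<open>f \<noteq> 0\<close> coeff_0_degree_minus_1 diff_less le_neq_implies_less less_one order_le_less_trans leading_coeff_0_iff degree_0)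
qed

text \<open>Leading coefficients need not be invertible in \<open>A\<close>, so each reduction step
  first multiplies \<open>f\<close> by the leading coefficient of \<open>g\<close>; \<open>k\<close>
  counts these steps.\<close>

lemma pseudo_division_over:
  fixes f g :: "'a::idom poly"
  assumes A: "subring_set A" and f: "f \<in> polys_over A" and g: "g \<in> polys_over A" "degree g > 0"
  shows "\<exists>k q r. q \<in> polys_over A \<and> r \<in> polys_over A \<and> degree r < degree g \<and>
           Polynomial.smult (lead_coeff g ^ k) f = q * g + r"
  using f
proof (induction "degree f" arbitrary: f rule: less_induct)
  case less
  note P = subring_polys_over[OF A]
  have l: "lead_coeff g \<in> A" "lead_coeff f \<in> A" using g less.prems coeff_in by auto
  show ?case
  proof (cases "degree f < degree g")
    case True
    then show ?thesis using less.prems subring_set_0[OF P]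
      by (intro exI[of _ 0] exI[of _ "0 :: 'a poly"] exI[of _ f]) auto
  next
    case False
    define m where "m = monom (lead_coeff f) (degree f - degree g)"
    let ?f = "Polynomial.smult (lead_coeff g) f - m * g"
    have m: "m \<in> polys_over A" unfolding m_def by (intro monom_polys_over A l)
    have sm: "Polynomial.smult a p \<in> polys_over A" if "a \<in> A" "p \<in> polys_over A" for a p
      using that A by (auto simp: polys_over_def intro: subring_set_mult)
    have "degree ?f < degree f"
      unfolding m_def using False g by (intro degree_cancel_lead) auto
    moreover have "?f \<in> polys_over A"
      by (intro subring_set_diff subring_set_mult P m g sm l less.prems)
    ultimately obtain k q r where *: "q \<in> polys_over A" "r \<in> polys_over A" "degree r < degree g"
      "Polynomial.smult (lead_coeff g ^ k) ?f = q * g + r" using less.hyps by blast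
    have "Polynomial.smult (lead_coeff g ^ Suc k) f = Polynomial.smult (lead_coeff g ^ k) ?f + Polynomial.smult (lead_coeff g ^ k) m * g"
      by (simp add: smult_diff_right mult.commute)
    also have "\<dots> = (q + Polynomial.smult (lead_coeff g ^ k) m) * g + r"
      using *(4) by (simp add: algebra_simps)
    finally show ?thesis using * sm[OF subring_set_power[OF A l(1)] m]
      by (meson P subring_set_add)
  qed
qed

text \<open>Among the polynomials \<open>p\<close> over \<open>A\<close> for which \<open>p(x)\<close> is a nonzero multiple of \<open>b\<close>, one of minimal
  degree divides, up to a scalar, a minimal-degree relation of \<open>x\<close>, and hence is constant.\<close>

lemma multiple_in_base:
  fixes x :: "'a::idom"
  assumes A: "subring_set A" and f: "f \<in> polys_over A" "f \<noteq> 0" "poly f x = 0"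
    and min: "\<And>p. p \<in> polys_over A \<Longrightarrow> poly p x = 0 \<Longrightarrow> degree p < degree f \<Longrightarrow> p = 0"
    and b: "b \<in> adjoin A x" "b \<noteq> 0"
  obtains v where "v \<in> adjoin A x" "b * v \<in> A" "b * v \<noteq> 0"
proof -
  note P = subring_polys_over[OF A] and B = subring_adjoin[OF A, of x]
  define I where "I p \<longleftrightarrow> p \<in> polys_over A \<and> poly p x \<noteq> 0 \<and> (\<exists>v\<in>adjoin A x. poly p x = b * v)" for p
  have ev: "poly p x \<in> adjoin A x" if "p \<in> polys_over A" for p using that by (auto simp: adjoin_def)
  obtain p0 where "p0 \<in> polys_over A" "b = poly p0 x" using b by (auto simp: adjoin_def)
  then have "I p0" unfolding I_def using b subring_set_1[OF B] by (metis mult.right_neutral)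
  then obtain p where p: "I p" and pmin: "\<And>q. I q \<Longrightarrow> degree p \<le> degree q"
    using ex_has_least_nat[of I p0 degree] by blast
  then obtain v where v: "v \<in> adjoin A x" "poly p x = b * v" and pA: "p \<in> polys_over A"
    and px: "poly p x \<noteq> 0"
    unfolding I_def by blast
  \<comment> \<open>At \<open>x\<close> such an \<open>r\<close> takes the value of
    \<open>- q * p\<close>, a multiple of \<open>b\<close>. If \<open>r\<close> were nonzero,
    minimality of \<open>f\<close> would make this value nonzero, contradicting minimality of
    \<open>p\<close>.\<close>
  have rem: "r = 0" if "q \<in> polys_over A" "r \<in> polys_over A" "degree r < degree p" "degree r < degree f"
    "r = h - q * p" "poly h x = 0" for q r h
  proof (rule ccontr)
    assume "r \<noteq> 0"
    then have rx: "poly r x \<noteq> 0" using min that by blast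
    have "poly r x = b * (0 - poly q x * v)" using that by (simp add: v)
    moreover have "0 - poly q x * v \<in> adjoin A x"
      by (intro subring_set_diff subring_set_mult B subring_set_0[OF B] ev that v)
    ultimately have "I r" unfolding I_def using that rx by blast
    then show False using pmin that by fastforce
  qed
  have fdeg: "degree f > 0"
    using f by (metis degree_0_id gr0I leading_coeff_0_iff poly_const_conv degree_eq_zeroE)
  \<comment> \<open>Otherwise the remainder of \<open>p\<close> modulo \<open>f\<close> has smaller
    degree and, up to a nonzero factor from \<open>A\<close>, the same value at
    \<open>x\<close>.\<close>
  have "degree p < degree f"
  proof (rule ccontr)
    assume "\<not> degree p < degree f"
    obtain k q r where *: "q \<in> polys_over A" "r \<in> polys_over A" "degree r < degree f"
      "Polynomial.smult (lead_coeff f ^ k) p = q * f + r"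
      using pseudo_division_over[OF A pA f(1) fdeg] by blast
    have "lead_coeff f ^ k \<in> A" using f(1) coeff_in A subring_set_power by blast
    have rx: "poly r x = lead_coeff f ^ k * poly p x"
      using arg_cong[OF *(4), of "\<lambda>p. poly p x"] f by simp
    then have "poly r x = b * (lead_coeff f ^ k * v)" by (simp add: v)
    moreover have "lead_coeff f ^ k * v \<in> adjoin A x"
      using \<open>lead_coeff f ^ k \<in> A\<close> subset_adjoin[OF A] by (intro subring_set_mult B v) auto
    moreover have "poly r x \<noteq> 0" using rx px f by simp
    ultimately have "I r" unfolding I_def using * by blast
    then show False using pmin * \<open>\<not> degree p < degree f\<close> by fastforce
  qed
  have "degree p = 0"
  proof (rule ccontr)
    assume "degree p \<noteq> 0"
    then obtain k q r where *: "q \<in> polys_over A" "r \<in> polys_over A" "degree r < degree p"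
      "Polynomial.smult (lead_coeff p ^ k) f = q * p + r"
      using pseudo_division_over[OF A f(1) pA] by blast
    have e: "r = Polynomial.smult (lead_coeff p ^ k) f - q * p" using *(4) by simp
    have "r = 0"
      by (rule rem[OF *(1-3) _ e]) (use *(3) f \<open>degree p < degree f\<close> in auto)
    then have eq: "Polynomial.smult (lead_coeff p ^ k) f = q * p" using * by simp
    have "p \<noteq> 0" using px by auto
    have nz: "Polynomial.smult (lead_coeff p ^ k) f \<noteq> 0" using f \<open>p \<noteq> 0\<close> by simp
    then have "q \<noteq> 0" using eq by auto
    have "degree f = degree (Polynomial.smult (lead_coeff p ^ k) f)" using nz by auto
    also have "\<dots> = degree q + degree p"
      unfolding eq by (rule degree_mult_eq) fact+
    finally have "degree f = degree q + degree p" .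
    \<comment> \<open>The cofactor \<open>q\<close> is itself a relation of \<open>x\<close>,
      because \<open>p\<close> does not vanish at \<open>x\<close>; its degree is too small for a
      nonzero relation.\<close>
    then have "degree q < degree f" using \<open>degree p \<noteq> 0\<close> by simp
    moreover have "poly q x = 0"
      using arg_cong[OF eq, of "\<lambda>p. poly p x"] f px by simp
    ultimately have "q = 0" using min * by blast
    with eq nz show False by simp
  qed
  then obtain a where "p = [:a:]" by (metis degree_eq_zeroE)
  then show ?thesis using that[of v] v px coeff_in[OF pA, of 0] by simp
qed

text \<open>If \<open>x\<close> is transcendental over \<open>A\<close>, any \<xi> may be the image
  of \<open>x\<close>; with \<open>b\<close> the value of \<open>p\<close> at \<open>x\<close>,
  taking \<open>a\<close> to be the leading coefficient of \<open>p\<close> ensures that the image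
  of \<open>p\<close> has a non-root. If \<open>x\<close> is algebraic, \<xi> is a root of the image
  of a relation \<open>f\<close> of least degree. Then \<open>a\<close> is the leading coefficient
  of \<open>f\<close> times a nonzero multiple of \<open>b\<close> lying in \<open>A\<close>: the
  first factor yields the root, the second keeps \<psi> from vanishing at \<open>b\<close>.\<close>

lemma extend_hom_adjoin:
  fixes x b :: "'a::idom"
  assumes A: "subring_set A" and b: "b \<in> adjoin A x" "b \<noteq> 0"
  shows "\<exists>a\<in>A. a \<noteq> 0 \<and> (\<forall>\<phi> :: 'a \<Rightarrow> 'k::alg_closed_field. hom_on A \<phi> \<longrightarrow> \<phi> a \<noteq> 0 \<longrightarrow>
           (\<exists>\<psi>. hom_on (adjoin A x) \<psi> \<and> (\<forall>c\<in>A. \<psi> c = \<phi> c) \<and> \<psi> b \<noteq> 0))"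
proof -
  note P = subring_polys_over[OF A]
  have const: "[:c:] \<in> polys_over A" if "c \<in> A" for c
    using monom_polys_over[OF A that, of 0] by (simp add: monom_0)
  have ext: "\<exists>\<psi>. hom_on (adjoin A x) \<psi> \<and> (\<forall>c\<in>A. \<psi> c = \<phi> c) \<and>
      (\<forall>p\<in>polys_over A. \<psi> (poly p x) = poly (map_poly \<phi> p) \<xi>)"
    if \<phi>: "hom_on A \<phi>" and \<xi>: "\<And>p. p \<in> polys_over A \<Longrightarrow> poly p x = 0 \<Longrightarrow> poly (map_poly \<phi> p) \<xi> = 0"
    for \<phi> :: "'a \<Rightarrow> 'k" and \<xi>
  proof -
    obtain \<psi> where \<psi>: "hom_on (adjoin A x) \<psi>"
      "\<And>p. p \<in> polys_over A \<Longrightarrow> \<psi> (poly p x) = poly (map_poly \<phi> p) \<xi>"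
      using hom_on_adjoin[OF A \<phi> \<xi>] by blast
    have "\<psi> c = \<phi> c" if "c \<in> A" for c
      using \<psi>(2)[OF const[OF that]] hom_on_0[OF A \<phi>] by (simp add: Polynomial.map_poly_pCons)
    with \<psi> show ?thesis by blast
  qed
  show ?thesis
  proof (cases "\<exists>f\<in>polys_over A. f \<noteq> 0 \<and> poly f x = 0")
    case False
    obtain p where p: "p \<in> polys_over A" "b = poly p x" using b by (auto simp: adjoin_def)
    then have "p \<noteq> 0" using b by auto
    have "\<exists>\<psi>. hom_on (adjoin A x) \<psi> \<and> (\<forall>c\<in>A. \<psi> c = \<phi> c) \<and> \<psi> b \<noteq> 0"
      if \<phi>: "hom_on A \<phi>" "\<phi> (lead_coeff p) \<noteq> 0" for \<phi> :: "'a \<Rightarrow> 'k"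
    proof -
      have z: "\<phi> 0 = 0" by (rule hom_on_0[OF A \<phi>(1)])
      let ?p = "map_poly \<phi> p"
      have "coeff ?p (degree p) \<noteq> 0" using \<phi> by (simp add: coeff_map_poly z)
      then have "?p \<noteq> 0" by auto
      obtain \<xi> where \<xi>: "poly ?p \<xi> \<noteq> 0"
      proof (cases "degree ?p = 0")
        case True
        then show ?thesis using \<open>?p \<noteq> 0\<close> that by (metis degree_eq_zeroE poly_const_conv pCons_0_0)
      next
        case False
        \<comment> \<open>A root of \<open>?p - 1\<close> is a point where \<open>?p\<close> takes
          the value 1.\<close>
        have "degree (?p - 1) > 0" using False
          by (metis add_diff_cancel diff_add_cancel degree_add_eq_left degree_1 gr0I degree_add_le le_zero_eq max.idem order.refl)
        then obtain \<xi> where "poly (?p - 1) \<xi> = 0" using alg_closed_imp_poly_has_root by blast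
        then show ?thesis using that[of \<xi>] by simp
      qed
      have "poly (map_poly \<phi> q) \<xi> = 0" if "q \<in> polys_over A" "poly q x = 0" for q
        using False that by (metis map_poly_0 poly_0)
      from ext[OF \<phi>(1) this] show ?thesis using p \<xi> by metis
    qed
    then show ?thesis using coeff_in[OF p(1)] \<open>p \<noteq> 0\<close> by (metis leading_coeff_0_iff)
  next
    case True
    then obtain f where f: "f \<in> polys_over A" "f \<noteq> 0" "poly f x = 0"
      and "\<And>p. p \<in> polys_over A \<Longrightarrow> p \<noteq> 0 \<Longrightarrow> poly p x = 0 \<Longrightarrow> degree f \<le> degree p"
      using ex_has_least_nat[of "\<lambda>f. f \<in> polys_over A \<and> f \<noteq> 0 \<and> poly f x = 0" _ degree] by blast
    then have min: "p = 0" if "p \<in> polys_over A" "poly p x = 0" "degree p < degree f" for p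
      using that by (meson linorder_not_less)
    obtain v where v: "v \<in> adjoin A x" "b * v \<in> A" "b * v \<noteq> 0"
      using multiple_in_base[OF A f min b] by blast
    have lA: "lead_coeff f \<in> A" using f coeff_in by blast
    have fdeg: "degree f > 0"
      using f by (metis degree_0_id gr0I leading_coeff_0_iff poly_const_conv degree_eq_zeroE)
    have "\<exists>\<psi>. hom_on (adjoin A x) \<psi> \<and> (\<forall>c\<in>A. \<psi> c = \<phi> c) \<and> \<psi> b \<noteq> 0"
      if \<phi>: "hom_on A \<phi>" "\<phi> (lead_coeff f * (b * v)) \<noteq> 0" for \<phi> :: "'a \<Rightarrow> 'k"
    proof -
      have z: "\<phi> 0 = 0" by (rule hom_on_0[OF A \<phi>(1)])
      note h = hom_on_map_poly[OF A \<phi>(1)]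
      have nz: "\<phi> (lead_coeff f) \<noteq> 0" "\<phi> (b * v) \<noteq> 0"
        using \<phi> hom_on_mult[OF \<phi>(1) lA v(2)] by auto
      have "degree f \<le> degree (map_poly \<phi> f)"
        using nz by (intro le_degree) (simp add: coeff_map_poly z)
      then obtain \<xi> where \<xi>: "poly (map_poly \<phi> f) \<xi> = 0"
        using fdeg alg_closed_imp_poly_has_root by (metis less_le_trans)
      \<comment> \<open>Induction on the degree of the relation: scaled by the leading coefficient
        of \<open>f\<close>, it can be reduced by a multiple of \<open>f\<close> to a relation of
        lower degree. The scaling factor has nonzero image and cancels at the end.\<close>
      have "poly (map_poly \<phi> p) \<xi> = 0" if "p \<in> polys_over A" "poly p x = 0" for p
        using that
      proof (induction "degree p" arbitrary: p rule: less_induct)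
        case less
        show ?case
        proof (cases "degree p < degree f")
          case True
          then have "p = 0" using min less.prems by blast
          then show ?thesis by simp
        next
          case False
          let ?m = "monom (lead_coeff p) (degree p - degree f)"
          let ?c = "[:lead_coeff f:]"
          have m: "?m \<in> polys_over A" by (intro monom_polys_over A coeff_in less.prems)
          have in1: "?c * p \<in> polys_over A" "?m * f \<in> polys_over A"
            by (intro subring_set_mult P const lA less.prems m f)+
          have "degree (?c * p - ?m * f) < degree p"
            using degree_cancel_lead[of f p] False fdeg f by simp
          then have "poly (map_poly \<phi> (?c * p - ?m * f)) \<xi> = 0"
            using f less.prems by (intro less.hyps subring_set_diff P in1) auto
          moreover have "map_poly \<phi> (?c * p - ?m * f) = map_poly \<phi> ?c * map_poly \<phi> p - map_poly \<phi> ?m * map_poly \<phi> f"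
            by (simp only: hom_on_diff[OF P h in1] hom_on_mult[OF h const[OF lA] less.prems(1)]
                hom_on_mult[OF h m f(1)])
          ultimately show ?thesis using \<xi> nz z by (simp add: Polynomial.map_poly_pCons)
        qed
      qed
      from ext[OF \<phi>(1) this] obtain \<psi> where \<psi>: "hom_on (adjoin A x) \<psi>" "\<forall>c\<in>A. \<psi> c = \<phi> c" by blast
      then have "\<psi> b * \<psi> v \<noteq> 0" using hom_on_mult[OF \<psi>(1) b(1) v(1)] v nz by simp
      with \<psi> show ?thesis by auto
    qed
    moreover have "lead_coeff f * (b * v) \<in> A" "lead_coeff f * (b * v) \<noteq> 0"
      using subring_set_mult[OF A lA v(2)] f v by auto
    ultimately show ?thesis by blast
  qed
qed

text \<open>The generators are adjoined one at a time. The element \<open>c\<close> of the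
  intermediate ring that controls the last extension plays the role of \<open>b\<close> in the
  induction hypothesis.\<close>

lemma extend_hom_finitely_generated:
  fixes A :: "'a::idom set"
  assumes A: "subring_set A" and S: "finite S"
  shows "\<exists>C. subring_set C \<and> A \<union> S \<subseteq> C \<and> (\<forall>b\<in>C. b \<noteq> 0 \<longrightarrow>
           (\<exists>a\<in>A. a \<noteq> 0 \<and> (\<forall>\<phi> :: 'a \<Rightarrow> 'k::alg_closed_field. hom_on A \<phi> \<longrightarrow> \<phi> a \<noteq> 0 \<longrightarrow>
             (\<exists>\<psi>. hom_on C \<psi> \<and> (\<forall>c\<in>A. \<psi> c = \<phi> c) \<and> \<psi> b \<noteq> 0))))"
  using S
proof (induction S rule: finite_induct)
  case empty
  then show ?case using A by (intro exI[of _ A]) auto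
next
  case (insert x S)
  from insert.IH obtain C where IH: "subring_set C \<and> A \<union> S \<subseteq> C \<and> (\<forall>b\<in>C. b \<noteq> 0 \<longrightarrow>
      (\<exists>a\<in>A. a \<noteq> 0 \<and> (\<forall>\<phi> :: 'a \<Rightarrow> 'k. hom_on A \<phi> \<longrightarrow> \<phi> a \<noteq> 0 \<longrightarrow>
        (\<exists>\<psi>. hom_on C \<psi> \<and> (\<forall>c\<in>A. \<psi> c = \<phi> c) \<and> \<psi> b \<noteq> 0))))" ..
  note C = IH[THEN conjunct1] IH[THEN conjunct2, THEN conjunct1]
    and ext = IH[THEN conjunct2, THEN conjunct2, rule_format]
  show ?case
  proof (intro exI[of _ "adjoin C x"] conjI ballI impI)
    show "subring_set (adjoin C x)" "A \<union> insert x S \<subseteq> adjoin C x"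
      using subring_adjoin[OF C(1)] subset_adjoin[OF C(1), of x] mem_adjoin[OF C(1), of x] C by auto
  next
    fix b assume b: "b \<in> adjoin C x" "b \<noteq> 0"
    from extend_hom_adjoin[OF C(1) b, where 'k = 'k]
    obtain c where c: "c \<in> C" and extc: "c \<noteq> 0 \<and> (\<forall>\<phi> :: 'a \<Rightarrow> 'k. hom_on C \<phi> \<longrightarrow> \<phi> c \<noteq> 0 \<longrightarrow>
             (\<exists>\<psi>. hom_on (adjoin C x) \<psi> \<and> (\<forall>c\<in>C. \<psi> c = \<phi> c) \<and> \<psi> b \<noteq> 0))" ..
    from ext[OF c extc[THEN conjunct1]]
    obtain a where a: "a \<in> A" and exta: "a \<noteq> 0 \<and> (\<forall>\<phi> :: 'a \<Rightarrow> 'k. hom_on A \<phi> \<longrightarrow> \<phi> a \<noteq> 0 \<longrightarrow>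
             (\<exists>\<psi>. hom_on C \<psi> \<and> (\<forall>c\<in>A. \<psi> c = \<phi> c) \<and> \<psi> c \<noteq> 0))" ..
    have "\<exists>\<psi>. hom_on (adjoin C x) \<psi> \<and> (\<forall>c\<in>A. \<psi> c = \<phi> c) \<and> \<psi> b \<noteq> 0"
      if \<phi>: "hom_on A \<phi>" "\<phi> a \<noteq> 0" for \<phi> :: "'a \<Rightarrow> 'k"
    proof -
      obtain \<psi> where \<psi>: "hom_on C \<psi>" "\<forall>c\<in>A. \<psi> c = \<phi> c" "\<psi> c \<noteq> 0" using exta \<phi> by blast
      obtain \<psi>' where "hom_on (adjoin C x) \<psi>'" "\<forall>c\<in>C. \<psi>' c = \<psi> c" "\<psi>' b \<noteq> 0"
        using extc \<psi>(1,3) by blast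
      then show ?thesis using \<psi>(2) C(2) by (intro exI[of _ \<psi>']) auto
    qed
    then show "\<exists>a\<in>A. a \<noteq> 0 \<and> (\<forall>\<phi> :: 'a \<Rightarrow> 'k. hom_on A \<phi> \<longrightarrow> \<phi> a \<noteq> 0 \<longrightarrow>
             (\<exists>\<psi>. hom_on (adjoin C x) \<psi> \<and> (\<forall>c\<in>A. \<psi> c = \<phi> c) \<and> \<psi> b \<noteq> 0))"
      using exta by (intro bexI[OF _ a]) blast
  qed
qed

section \<open>Polynomial functions\<close>

text \<open>Polynomials are represented by functions: over the infinite field of complex numbers a
  polynomial is nonzero iff it has a nonzero value. \<open>V\<close> bounds the variables that may
  occur.\<close>

inductive polyfun :: "'v set \<Rightarrow> (('v \<Rightarrow> complex) \<Rightarrow> complex) \<Rightarrow> bool" for V where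
  const: "polyfun V (\<lambda>_. c)"
| var: "v \<in> V \<Longrightarrow> polyfun V (\<lambda>x. x v)"
| add: "polyfun V f \<Longrightarrow> polyfun V g \<Longrightarrow> polyfun V (\<lambda>x. f x + g x)"
| mult: "polyfun V f \<Longrightarrow> polyfun V g \<Longrightarrow> polyfun V (\<lambda>x. f x * g x)"

named_theorems polyfun_intros
declare polyfun.intros [polyfun_intros]

lemma polyfun_diff [polyfun_intros]:
  assumes "polyfun V f" "polyfun V g" shows "polyfun V (\<lambda>x. f x - g x)"
  using polyfun.add[OF assms(1) polyfun.mult[OF polyfun.const[of V "-1"] assms(2)]] by simp

lemma polyfun_uminus [polyfun_intros]: "polyfun V f \<Longrightarrow> polyfun V (\<lambda>x. - f x)"
  using polyfun_diff[OF polyfun.const[of V 0]] by simp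

lemma polyfun_sum [polyfun_intros]:
  "(\<And>i. i \<in> S \<Longrightarrow> polyfun V (f i)) \<Longrightarrow> polyfun V (\<lambda>x. \<Sum>i\<in>S. f i x)"
  by (induction S rule: infinite_finite_induct) (auto intro: polyfun.intros)

lemma polyfun_prod [polyfun_intros]:
  "(\<And>i. i \<in> S \<Longrightarrow> polyfun V (f i)) \<Longrightarrow> polyfun V (\<lambda>x. \<Prod>i\<in>S. f i x)"
  by (induction S rule: infinite_finite_induct) (auto intro: polyfun.intros)

lemma polyfun_subst:
  assumes "polyfun V f" "\<And>v. v \<in> V \<Longrightarrow> polyfun W (\<lambda>x. \<Gamma> x v)"
  shows "polyfun W (\<lambda>x. f (\<Gamma> x))"
  using assms by (induction) (auto intro: polyfun.intros)

lemma polyfun_mono: "polyfun V f \<Longrightarrow> V \<subseteq> W \<Longrightarrow> polyfun W f"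
  using polyfun_subst[of V f W "\<lambda>x. x"] by (auto intro: polyfun.var)

lemma polyfun_cong: "polyfun V f \<Longrightarrow> (\<And>v. v \<in> V \<Longrightarrow> x v = y v) \<Longrightarrow> f x = f y"
  by (induction rule: polyfun.induct) auto

section \<open>Restriction to curves and lines\<close>

lemma polyfun_along_curve:
  assumes "polyfun V f"
  shows "\<exists>p. \<forall>t. f (\<lambda>v. poly (\<gamma> v) t) = poly p t"
  using assms
proof induction
  case (const c) show ?case by (rule exI[of _ "[:c:]"]) simp
next
  case (var v) show ?case by blast
next
  case (add f g) then show ?case by (metis poly_add)
next
  case (mult f g) then show ?case by (metis poly_mult)
qed

lemma polyfun_along_line:
  assumes "polyfun V f"
  obtains p where "\<And>t. f (\<lambda>v. u v + t * w v) = poly p t"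
  using polyfun_along_curve[OF assms, of "\<lambda>v. [:u v, w v:]"] by auto

text \<open>On the line through \<open>u\<close> and \<open>w\<close> both functions become nonzero
  univariate polynomials, whose product has only finitely many roots.\<close>

lemma polyfun_mult_nonzero:
  assumes "polyfun V f" "polyfun W g" "f u \<noteq> 0" "g w \<noteq> 0"
  shows "\<exists>x. f x * g x \<noteq> 0"
proof -
  obtain p q where p: "\<And>t. f (\<lambda>v. u v + t * (w v - u v)) = poly p t"
    and q: "\<And>t. g (\<lambda>v. u v + t * (w v - u v)) = poly q t"
    using polyfun_along_line[OF assms(1)] polyfun_along_line[OF assms(2)] by metis
  have "p \<noteq> 0" "q \<noteq> 0" using p[of 0] q[of 1] assms by auto
  then have "finite {t. poly (p * q) t = 0}" by (intro poly_roots_finite) simp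
  then obtain t where "poly (p * q) t \<noteq> 0"
    using infinite_UNIV_char_0[where 'a = complex] by (metis (mono_tags) UNIV_eq_I mem_Collect_eq)
  then show ?thesis by (metis p q poly_mult)
qed

text \<open>The extension lemma is about subrings of a type of class \<open>idom\<close>, so the
  polynomial functions in all variables are made into such a type.\<close>

typedef 'v pfun = "{f :: ('v \<Rightarrow> complex) \<Rightarrow> complex. polyfun UNIV f}"
  morphisms papp Pfun
  by (auto intro: polyfun.const)

setup_lifting type_definition_pfun

instantiation pfun :: (type) idom
begin
lift_definition zero_pfun :: "'a pfun" is "\<lambda>_. 0" by (rule polyfun.const)
lift_definition one_pfun :: "'a pfun" is "\<lambda>_. 1" by (rule polyfun.const)
lift_definition plus_pfun :: "'a pfun \<Rightarrow> 'a pfun \<Rightarrow> 'a pfun" is "\<lambda>f g x. f x + g x" by (rule polyfun.add)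
lift_definition times_pfun :: "'a pfun \<Rightarrow> 'a pfun \<Rightarrow> 'a pfun" is "\<lambda>f g x. f x * g x" by (rule polyfun.mult)
lift_definition minus_pfun :: "'a pfun \<Rightarrow> 'a pfun \<Rightarrow> 'a pfun" is "\<lambda>f g x. f x - g x" by (rule polyfun_diff)
lift_definition uminus_pfun :: "'a pfun \<Rightarrow> 'a pfun" is "\<lambda>f x. - f x" by (rule polyfun_uminus)
instance
proof
  fix a b :: "'a pfun"
  assume "a \<noteq> 0" "b \<noteq> 0"
  then show "a * b \<noteq> 0"
    by transfer (metis polyfun_mult_nonzero)
qed (transfer; simp add: algebra_simps fun_eq_iff)+
end

lemma papp_Pfun: "polyfun UNIV f \<Longrightarrow> papp (Pfun f) = f"
  by (simp add: Pfun_inverse)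

lemma Pfun_eq_iff: "polyfun UNIV f \<Longrightarrow> polyfun UNIV g \<Longrightarrow> Pfun f = Pfun g \<longleftrightarrow> f = g"
  by (simp add: Pfun_inject)

text \<open>As functions of \<open>z\<close>, the coefficients of \<open>p z\<close> are the
  homogeneous components of \<open>f\<close>. The bound \<open>n\<close> is uniform in
  \<open>z\<close>, so that their sum is finite with fixed limits.\<close>

lemma polyfun_scale_expansion:
  assumes "polyfun V f"
  shows "\<exists>p n. (\<forall>z s. f (\<lambda>v. s * z v) = poly (p z) s) \<and> (\<forall>k. polyfun V (\<lambda>z. coeff (p z) k)) \<and> (\<forall>z. degree (p z) \<le> n)"
  using assms
proof induction
  case (const c)
  show ?case by (rule exI[of _ "\<lambda>_. [:c:]"]) (auto intro: polyfun.const)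
next
  case (var v)
  have "polyfun V (\<lambda>z. coeff (monom (z v) 1) k)" for k
    using var by (cases "k = 1") (auto intro: polyfun.intros)
  moreover have "s * z v = poly (monom (z v) 1) s" for s :: complex and z by (simp add: poly_monom)
  ultimately show ?case
    by (intro exI[of _ "\<lambda>z. monom (z v) 1"] exI[of _ 1]) (auto intro: degree_monom_le)
next
  case (add f g)
  then obtain p n q m where
    "\<forall>z s. f (\<lambda>v. s * z v) = poly (p z) s" "\<forall>k. polyfun V (\<lambda>z. coeff (p z) k)" "\<forall>z. degree (p z) \<le> n"
    "\<forall>z s. g (\<lambda>v. s * z v) = poly (q z) s" "\<forall>k. polyfun V (\<lambda>z. coeff (q z) k)" "\<forall>z. degree (q z) \<le> m"
    by blast
  then show ?case
    by (intro exI[of _ "\<lambda>z. p z + q z"] exI[of _ "max n m"])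
      (auto intro!: polyfun.add order.trans[OF degree_add_le_max] simp: max.coboundedI1 max.coboundedI2)
next
  case (mult f g)
  then obtain p n q m where
    "\<forall>z s. f (\<lambda>v. s * z v) = poly (p z) s" "\<forall>k. polyfun V (\<lambda>z. coeff (p z) k)" "\<forall>z. degree (p z) \<le> n"
    "\<forall>z s. g (\<lambda>v. s * z v) = poly (q z) s" "\<forall>k. polyfun V (\<lambda>z. coeff (q z) k)" "\<forall>z. degree (q z) \<le> m"
    by blast
  then show ?case
    by (intro exI[of _ "\<lambda>z. p z * q z"] exI[of _ "n + m"])
      (auto intro!: polyfun_intros order.trans[OF degree_mult_le] add_mono simp: coeff_mult)
qed

text \<open>If \<open>f\<close> vanished along every curve \<open>s \<mapsto> s y + s\<^sup>2 q\<close>, then dividing by \<open>s\<^sup>m\<close>, with \<open>m\<close> the least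
  degree occurring in \<open>f\<close>, and letting \<open>s \<rightarrow> 0\<close> would make the component of degree \<open>m\<close> vanish at \<open>y\<close>.\<close>

lemma polyfun_nonzero_linear_plus_quadratic:
  assumes f: "polyfun V f" "f u \<noteq> 0"
  shows "\<exists>y. \<forall>q. \<exists>s. f (\<lambda>v. s * y v + s\<^sup>2 * q v) \<noteq> 0"
proof -
  obtain p n where p: "\<And>z s. f (\<lambda>v. s * z v) = poly (p z) s"
    and coeff: "\<And>k. polyfun V (\<lambda>z. coeff (p z) k)" and deg: "\<And>z. degree (p z) \<le> n"
    using polyfun_scale_expansion[OF f(1)] by blast
  have "p u \<noteq> 0" using p[of 1 u] f by auto
  then have "\<exists>k z. coeff (p z) k \<noteq> 0" by (metis leading_coeff_0_iff)
  define m where "m = (LEAST m. \<exists>z. coeff (p z) m \<noteq> 0)"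
  obtain y where y: "coeff (p y) m \<noteq> 0"
    using LeastI_ex[OF \<open>\<exists>k z. coeff (p z) k \<noteq> 0\<close>] unfolding m_def by blast
  have low: "coeff (p z) k = 0" if "k < m" for k z
    using not_less_Least[of k "\<lambda>m. \<exists>z. coeff (p z) m \<noteq> 0"] that unfolding m_def by blast
  have "\<exists>s. f (\<lambda>v. s * y v + s\<^sup>2 * q v) \<noteq> 0" for q
  proof (rule ccontr)
    assume "\<not> ?thesis"
    then have zero: "f (\<lambda>v. s * (y v + s * q v)) = 0" for s
      by (simp add: power2_eq_square algebra_simps)
    \<comment> \<open>\<open>F z s\<close> is the value of \<open>f\<close> at \<open>s z\<close>
      divided by \<open>s ^ m\<close>; for \<open>m \<le> n\<close> it makes sense at
      \<open>s = 0\<close>, where only the component of degree \<open>m\<close> survives.\<close>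
    define F where "F z s = (\<Sum>k=m..n. coeff (p z) k * s ^ (k - m))" for z s
    have fF: "f (\<lambda>v. s * z v) = s ^ m * F z s" for z s
    proof -
      have "f (\<lambda>v. s * z v) = (\<Sum>k\<le>n. coeff (p z) k * s ^ k)"
        unfolding p poly_altdef using deg by (intro sum.mono_neutral_left) (auto simp: coeff_eq_0)
      also have "\<dots> = (\<Sum>k=m..n. coeff (p z) k * s ^ k)"
        by (intro sum.mono_neutral_right) (auto simp: low not_le)
      also have "\<dots> = s ^ m * F z s"
        unfolding F_def sum_distrib_left by (intro sum.cong) (auto simp flip: power_add)
      finally show ?thesis .
    qed
    have "\<forall>k. \<exists>c. \<forall>s. coeff (p (\<lambda>v. y v + s * q v)) k = poly c s"
      using polyfun_along_line[OF coeff] by metis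
    then obtain c where c: "\<And>k s. coeff (p (\<lambda>v. y v + s * q v)) k = poly (c k) s" by metis
    \<comment> \<open>Along \<open>y + s q\<close> the quotient is a polynomial in \<open>s\<close>
      alone. It vanishes for all nonzero \<open>s\<close>, hence also at 0.\<close>
    define P where "P = (\<Sum>k=m..n. c k * monom 1 (k - m))"
    have P: "poly P s = F (\<lambda>v. y v + s * q v) s" for s
      by (simp add: P_def F_def c poly_sum poly_monom)
    have "UNIV - {0} \<subseteq> {s. poly P s = 0}"
      using zero fF[of _ "\<lambda>v. y v + _ * q v"] P by auto
    then have "P = 0"
      using poly_roots_finite[of P] infinite_UNIV_char_0[where 'a = complex] finite_subset
      by (metis finite.emptyI finite_Diff_insert finite_Diff2)
    then have "F y 0 = 0" using P[of 0] by simp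
    moreover have "m \<le> n" using y deg[of y] le_degree order.trans by blast
    then have "F y 0 = coeff (p y) m + (\<Sum>k\<in>{m..n} - {m}. coeff (p y) k * 0 ^ (k - m))"
      unfolding F_def by (subst sum.remove[of _ m]) auto
    moreover have "\<dots> = coeff (p y) m"
      by (auto intro!: sum.neutral)
    ultimately show False using y by simp
  qed
  then show ?thesis by blast
qed

text \<open>If \<open>L x = y\<close>, the image of \<open>s x\<close> is
  \<open>s y + s\<^sup>2 Q x\<close>, a curve of the kind treated before. There \<open>y\<close> is
  chosen before \<open>q\<close>, which is essential here, as \<open>q = Q x\<close> depends on
  \<open>y\<close>.\<close>

lemma polyfun_nonzero_on_linear_plus_quadratic_image:
  assumes f: "polyfun I f" "f u \<noteq> 0"
    and lin: "\<And>s x i. L i (\<lambda>j. s * x j) = s * L i x" and quad: "\<And>s x i. Q i (\<lambda>j. s * x j) = s\<^sup>2 * Q i x"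
    and surj: "\<And>y. \<exists>x. \<forall>i\<in>I. L i x = y i"
  shows "\<exists>x. f (\<lambda>i. L i x + Q i x) \<noteq> 0"
proof -
  from polyfun_nonzero_linear_plus_quadratic[of I f u, OF f]
  obtain y where y: "\<forall>q. \<exists>s. f (\<lambda>v. s * y v + s\<^sup>2 * q v) \<noteq> 0" ..
  obtain x where x: "\<forall>i\<in>I. L i x = y i" using surj by blast
  from spec[OF y, of "\<lambda>i. Q i x"]
  obtain s where s: "f (\<lambda>v. s * y v + s\<^sup>2 * Q v x) \<noteq> 0" ..
  have "f (\<lambda>v. s * y v + s\<^sup>2 * Q v x) = f (\<lambda>i. L i (\<lambda>j. s * x j) + Q i (\<lambda>j. s * x j))"
    using x by (intro polyfun_cong[of I f] f) (simp add: lin quad)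
  with s have "f (\<lambda>i. L i (\<lambda>j. s * x j) + Q i (\<lambda>j. s * x j)) \<noteq> 0" by simp
  then show ?thesis by (rule exI[of _ "\<lambda>j. s * x j"])
qed

section \<open>Generic solvability of polynomial systems\<close>

lemma Pfun_arith:
  assumes "polyfun UNIV f" "polyfun UNIV g"
  shows "Pfun f + Pfun g = Pfun (\<lambda>x. f x + g x)" "Pfun f * Pfun g = Pfun (\<lambda>x. f x * g x)"
    "Pfun f - Pfun g = Pfun (\<lambda>x. f x - g x)"
  using assms by (simp_all add: plus_pfun.abs_eq times_pfun.abs_eq minus_pfun.abs_eq eq_onp_def)

text \<open>By \<open>dominant\<close>, replacing the entries in \<open>I\<close> by
  \<open>g\<close> is an injective operation on polynomials in the channel. Since \<open>g\<close>
  and \<open>D\<close> involve no entry in \<open>I\<close>, the replacement leaves them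
  unchanged.\<close>

lemma generic_solvability:
  fixes g :: "'e \<Rightarrow> ('u \<Rightarrow> complex) \<Rightarrow> ('e \<Rightarrow> complex) \<Rightarrow> complex"
    and D :: "('u \<Rightarrow> complex) \<Rightarrow> ('e \<Rightarrow> complex) \<Rightarrow> complex"
  assumes "I \<subseteq> E" and J: "finite J"
    and g: "\<And>i. i \<in> I \<Longrightarrow> polyfun (J <+> (E - I)) (\<lambda>v. g i (v \<circ> Inl) (v \<circ> Inr))"
    and D: "polyfun (J <+> (E - I)) (\<lambda>v. D (v \<circ> Inl) (v \<circ> Inr))" and D0: "D x\<^sub>0 h\<^sub>0 \<noteq> 0"
    and dominant: "\<And>R h. polyfun E R \<Longrightarrow> R h \<noteq> 0 \<Longrightarrow> \<exists>x h. R (\<lambda>e. if e \<in> I then g e x h else h e) \<noteq> 0"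
  shows "\<exists>R. polyfun E R \<and> (\<exists>h. R h \<noteq> 0) \<and>
           (\<forall>h. R h \<noteq> 0 \<longrightarrow> (\<exists>x. (\<forall>i\<in>I. h i = g i x h) \<and> D x h \<noteq> 0))"
proof -
  \<comment> \<open>\<Gamma> is the channel with the entries in \<open>I\<close> replaced by
    \<open>g\<close>, and \<Delta> adds the unknowns to it. \<open>T\<close> is pull-back along
    \<Gamma>, and its image \<open>A\<close> is the copy of the small ring inside the large
    one.\<close>
  define \<Gamma> where "\<Gamma> v e = (if e \<in> I then g e (v \<circ> Inl) (v \<circ> Inr) else v (Inr e))" for v :: "'u + 'e \<Rightarrow> complex" and e
  define \<Delta> where "\<Delta> v = case_sum (v \<circ> Inl) (\<Gamma> v)" for v
  define T where "T R = Pfun (\<lambda>v. R (\<Gamma> v))" for R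
  define A where "A = T ` {R. polyfun E R}"
  have \<Gamma>: "polyfun UNIV (\<lambda>v. \<Gamma> v e)" for e
    using polyfun_mono[OF g, of e UNIV] by (cases "e \<in> I") (auto simp: \<Gamma>_def intro: polyfun.var)
  have T: "polyfun UNIV (\<lambda>v. R (\<Gamma> v))" if "polyfun E R" for R
    using polyfun_subst[OF that] \<Gamma> by blast
  have inj: "R = R'" if R: "polyfun E R" "polyfun E R'" "T R = T R'" for R R'
  proof (rule ccontr)
    assume "R \<noteq> R'"
    then obtain h where "R h - R' h \<noteq> 0" by auto
    then obtain x h' where "R (\<lambda>e. if e \<in> I then g e x h' else h' e) - R' (\<lambda>e. if e \<in> I then g e x h' else h' e) \<noteq> 0"
      using dominant[OF polyfun_diff[OF R(1,2)]] by blast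
    moreover have "\<Gamma> (case_sum x h') = (\<lambda>e. if e \<in> I then g e x h' else h' e)"
      by (auto simp: \<Gamma>_def comp_def)
    moreover have "(\<lambda>v. R (\<Gamma> v)) = (\<lambda>v. R' (\<Gamma> v))"
      using R(3) T[OF R(1)] T[OF R(2)] by (simp add: T_def Pfun_eq_iff)
    ultimately show False by (metis diff_self)
  qed
  have one: "T (\<lambda>_. 1) = 1" unfolding T_def by (simp add: one_pfun_def)
  have arith: "T R + T R' = T (\<lambda>h. R h + R' h)" "T R * T R' = T (\<lambda>h. R h * R' h)"
    "T R - T R' = T (\<lambda>h. R h - R' h)" if "polyfun E R" "polyfun E R'" for R R'
    using T[OF that(1)] T[OF that(2)] by (simp_all add: T_def Pfun_arith)
  have A: "subring_set A"
    unfolding subring_set_def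
  proof (intro conjI ballI)
    show "1 \<in> A" unfolding A_def using one polyfun.const[of E 1] by force
    fix a b assume "a \<in> A" "b \<in> A"
    then show "a - b \<in> A" "a * b \<in> A"
      by (auto simp: A_def arith intro!: imageI polyfun_intros)
  qed
  \<comment> \<open>Evaluation at \<open>h\<close>, transported to \<open>A\<close> through the
    inverse of \<open>T\<close>.\<close>
  define \<phi> where "\<phi> h a = (THE R. polyfun E R \<and> T R = a) h" for h a
  have \<phi>_T: "\<phi> h (T R) = R h" if "polyfun E R" for h R
  proof -
    have "(THE R'. polyfun E R' \<and> T R' = T R) = R"
      using that inj by (intro the_equality) auto
    then show ?thesis by (simp add: \<phi>_def)
  qed
  have hom_\<phi>: "hom_on A (\<phi> h)" for h
    unfolding hom_on_def
  proof (intro conjI ballI)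
    show "\<phi> h 1 = 1" using \<phi>_T[OF polyfun.const[of E 1]] one by simp
    fix a b assume "a \<in> A" "b \<in> A"
    then show "\<phi> h (a + b) = \<phi> h a + \<phi> h b" "\<phi> h (a * b) = \<phi> h a * \<phi> h b"
      by (auto simp: A_def arith \<phi>_T polyfun.add polyfun.mult)
  qed
  define X :: "'u \<Rightarrow> ('u + 'e) pfun" where "X j = Pfun (\<lambda>v. v (Inl j))" for j
  obtain C where C: "subring_set C" "A \<union> X ` J \<subseteq> C"
    and ext: "\<forall>b\<in>C. b \<noteq> 0 \<longrightarrow> (\<exists>a\<in>A. a \<noteq> 0 \<and> (\<forall>\<phi> :: _ \<Rightarrow> complex. hom_on A \<phi> \<longrightarrow> \<phi> a \<noteq> 0 \<longrightarrow>
             (\<exists>\<psi>. hom_on C \<psi> \<and> (\<forall>c\<in>A. \<psi> c = \<phi> c) \<and> \<psi> b \<noteq> 0)))"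
    using extend_hom_finitely_generated[OF A finite_imageI[OF J, of X], where 'k = complex]
    by (elim exE conjE) (rule that)
  have \<Delta>: "polyfun UNIV (\<lambda>v. P (\<Delta> v))" if "polyfun (J <+> E) P" for P
    using that by (rule polyfun_subst) (auto simp: \<Delta>_def \<Gamma> polyfun.var)
  have C_mem: "Pfun (\<lambda>v. P (\<Delta> v)) \<in> C" if "polyfun (J <+> E) P" for P
    using that
  proof induction
    case (const c)
    have "T (\<lambda>_. c) \<in> A" unfolding A_def by (auto intro: polyfun.const)
    then show ?case using C by (auto simp: T_def)
  next
    case (var w)
    then consider j where "w = Inl j" "j \<in> J" | e where "w = Inr e" "e \<in> E" by auto
    then show ?case
    proof cases
      case 1 then show ?thesis using C by (auto simp: \<Delta>_def X_def)
    next
      case 2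
      then have "T (\<lambda>h. h e) \<in> A" unfolding A_def by (auto intro: polyfun.var)
      then show ?thesis using C 2 by (auto simp: \<Delta>_def T_def)
    qed
  qed (use subring_set_add[OF C(1)] subring_set_mult[OF C(1)] in \<open>auto simp: \<Delta> simp flip: Pfun_arith\<close>)
  \<comment> \<open>An extension of evaluation at \<open>h\<close> is again an evaluation: its point
    has \<open>h\<close> as channel and the images of the coordinate functions \<open>X\<close> as
    unknowns.\<close>
  have eval: "\<psi> (Pfun (\<lambda>v. P (\<Delta> v))) = P (case_sum (\<lambda>j. \<psi> (X j)) h)"
    if \<psi>: "hom_on C \<psi>" "\<forall>c\<in>A. \<psi> c = \<phi> h c" and P: "polyfun (J <+> E) P" for \<psi> h P
    using P
  proof induction
    case (const c)
    have "T (\<lambda>_. c) \<in> A" unfolding A_def by (auto intro: polyfun.const)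
    then show ?case using \<psi>(2) \<phi>_T[OF polyfun.const, of h c] by (auto simp: T_def)
  next
    case (var w)
    then consider j where "w = Inl j" "j \<in> J" | e where "w = Inr e" "e \<in> E" by auto
    then show ?case
    proof cases
      case 1 then show ?thesis by (auto simp: \<Delta>_def X_def)
    next
      case 2
      then have "T (\<lambda>h. h e) \<in> A" unfolding A_def by (auto intro: polyfun.var)
      then show ?thesis using 2 \<psi>(2) \<phi>_T[OF polyfun.var[OF 2(2)], of h] by (auto simp: \<Delta>_def T_def)
    qed
  next
    case (add f k)
    then show ?case
      using hom_on_add[OF \<psi>(1) C_mem[OF add.hyps(1)] C_mem[OF add.hyps(2)]] by (simp add: Pfun_arith \<Delta>)
  next
    case (mult f k)
    then show ?case
      using hom_on_mult[OF \<psi>(1) C_mem[OF mult.hyps(1)] C_mem[OF mult.hyps(2)]] by (simp add: Pfun_arith \<Delta>)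
  qed
  have \<Delta>_id: "P (\<Delta> v) = P v" if "polyfun (J <+> (E - I)) P" for P v
    using that by (rule polyfun_cong) (auto simp: \<Delta>_def \<Gamma>_def)
  have sub: "J <+> (E - I) \<subseteq> J <+> E" by auto
  let ?D = "\<lambda>v. D (v \<circ> Inl) (v \<circ> Inr)"
  note D' = polyfun_mono[OF D sub]
  define b where "b = Pfun (\<lambda>v. ?D (\<Delta> v))"
  have "b \<noteq> 0"
  proof
    assume "b = 0"
    then have "papp b (case_sum x\<^sub>0 h\<^sub>0) = 0" by (simp add: zero_pfun.rep_eq)
    moreover have "papp b = (\<lambda>v. ?D (\<Delta> v))" unfolding b_def by (rule papp_Pfun) (rule \<Delta>[OF D'])
    ultimately have "?D (\<Delta> (case_sum x\<^sub>0 h\<^sub>0)) = 0" by simp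
    then have "?D (case_sum x\<^sub>0 h\<^sub>0) = 0" unfolding \<Delta>_id[OF D] .
    then show False using D0 by (simp add: comp_def)
  qed
  then obtain a where a: "a \<in> A" "a \<noteq> 0" and exta: "\<And>\<phi> :: _ \<Rightarrow> complex. hom_on A \<phi> \<Longrightarrow> \<phi> a \<noteq> 0 \<Longrightarrow>
             (\<exists>\<psi>. hom_on C \<psi> \<and> (\<forall>c\<in>A. \<psi> c = \<phi> c) \<and> \<psi> b \<noteq> 0)"
    using bspec[OF ext, of b] C_mem[OF D'] unfolding b_def by blast
  then obtain R where R: "polyfun E R" "a = T R" by (auto simp: A_def)
  have "\<exists>h. R h \<noteq> 0"
  proof (rule ccontr)
    assume "\<not> ?thesis"
    then have "R = (\<lambda>_. 0)" by auto
    then have "a = 0" by (simp add: R T_def zero_pfun_def)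
    with a show False by simp
  qed
  moreover have "\<exists>x. (\<forall>i\<in>I. h i = g i x h) \<and> D x h \<noteq> 0" if "R h \<noteq> 0" for h
  proof -
    have "\<phi> h a \<noteq> 0" using that R \<phi>_T by simp
    then obtain \<psi> where \<psi>: "hom_on C \<psi>" "\<forall>c\<in>A. \<psi> c = \<phi> h c" "\<psi> b \<noteq> 0"
      using exta[OF hom_\<phi>] by blast
    define \<xi> where "\<xi> = (\<lambda>j. \<psi> (X j))"
    have "D \<xi> h \<noteq> 0"
      using eval[OF \<psi>(1,2) D'] \<psi>(3) by (simp add: b_def \<xi>_def comp_def)
    moreover have "h i = g i \<xi> h" if "i \<in> I" for i
    proof -
      let ?G = "\<lambda>v. g i (v \<circ> Inl) (v \<circ> Inr)"
      \<comment> \<open>The difference of the two sides of equation \<open>i\<close> becomes zero in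
        the large ring after substitution, so \<psi> sends it to 0; by \<open>eval\<close> this is
        the equation at \<xi> and \<open>h\<close>.\<close>
      have P: "polyfun (J <+> E) (\<lambda>v. v (Inr i) - ?G v)"
        using that \<open>I \<subseteq> E\<close> by (intro polyfun_intros polyfun_mono[OF g sub]) auto
      have "\<Delta> v (Inr i) = ?G v" for v using that by (simp add: \<Delta>_def \<Gamma>_def)
      then have "(\<lambda>v. \<Delta> v (Inr i) - ?G (\<Delta> v)) = (\<lambda>_. 0)"
        unfolding \<Delta>_id[OF g[OF that]] by simp
      then have "Pfun (\<lambda>v. \<Delta> v (Inr i) - ?G (\<Delta> v)) = 0" by (simp add: zero_pfun_def)
      then show ?thesis
        using eval[OF \<psi>(1,2) P] hom_on_0[OF C(1) \<psi>(1)] by (simp add: \<xi>_def comp_def)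
    qed
    ultimately show ?thesis by blast
  qed
  ultimately show ?thesis using R(1) by blast
qed

section \<open>Polynomials in independent atomless random variables\<close>

lemma polyfun_measurable: "polyfun E f \<Longrightarrow> f \<in> borel_measurable (Pi\<^sub>M E (\<lambda>_. borel))"
proof (induction rule: polyfun.induct)
  case (var v)
  then show ?case by (rule measurable_component_singleton)
qed simp_all

text \<open>Induction on \<open>E\<close> by Fubini: for almost all values of the other coordinates
  \<open>f\<close> is a nonzero polynomial in the new one, and its finitely many roots form a null
  set because there are no atoms.\<close>

lemma AE_PiM_polyfun_nonzero:
  fixes D :: "'e \<Rightarrow> complex measure"
  assumes "finite E" and prob: "\<And>e. prob_space (D e)" and sets: "\<And>e. sets (D e) = sets borel"
    and atomless: "\<And>e z. e \<in> E \<Longrightarrow> emeasure (D e) {z} = 0"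
    and f: "polyfun E f" "f u \<noteq> 0"
  shows "AE x in Pi\<^sub>M E D. f x \<noteq> 0"
  using assms(1) atomless f
proof (induction E arbitrary: f rule: finite_induct)
  case empty
  have "f x = f u" for x by (rule polyfun_cong[OF empty(2)]) simp
  then have "f x \<noteq> 0" for x using empty(3) by metis
  then show ?case by (intro AE_I2)
next
  case (insert e E)
  interpret product_prob_space D
    by (rule product_prob_spaceI[OF prob])
  \<comment> \<open>Freezing the new coordinate at \<open>u e\<close> leaves the nonzero value at
    \<open>u\<close> intact, so the induction hypothesis applies.\<close>
  have "polyfun E (\<lambda>x. f (x(e := u e)))"
    using insert.prems(2)
  proof (rule polyfun_subst)
    fix v assume "v \<in> insert e E"
    then show "polyfun E (\<lambda>x. (x(e := u e)) v)"
      by (cases "v = e") (simp_all add: polyfun.const polyfun.var)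
  qed
  moreover have "f (u(e := u e)) \<noteq> 0" using insert.prems by simp
  ultimately have IH: "AE x in Pi\<^sub>M E D. f (x(e := u e)) \<noteq> 0"
    using insert.IH insert.prems(1) by auto
  have inner: "AE z in D e. f (x(e := z)) \<noteq> 0" if "f (x(e := u e)) \<noteq> 0" for x
  proof -
    obtain p where p: "\<And>t. f (\<lambda>v. poly (if v = e then [:0, 1:] else [:x v:]) t) = poly p t"
      using polyfun_along_curve[OF insert.prems(2), of "\<lambda>v. if v = e then [:0, 1:] else [:x v:]"] by blast
    have "(\<lambda>v. poly (if v = e then [:0, 1:] else [:x v:]) t) = x(e := t)" for t by auto
    with p have p: "f (x(e := t)) = poly p t" for t by simp
    then have "p \<noteq> 0" using that by auto
    then have "finite {z. poly p z = 0}" by (rule poly_roots_finite)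
    then have "(\<Union>z\<in>{z. poly p z = 0}. {z}) \<in> null_sets (D e)"
      by (intro null_sets_UN' countable_finite) (auto simp: null_sets_def sets insert.prems)
    then show ?thesis by (rule AE_I') (auto simp: p) 
  qed
  have sets_eq: "sets (Pi\<^sub>M (insert e E) D) = sets (Pi\<^sub>M (insert e E) (\<lambda>_. borel))"
    by (rule sets_PiM_cong) (auto simp: sets)
  have meas: "f \<in> borel_measurable (Pi\<^sub>M (insert e E) D)"
    using polyfun_measurable[OF insert.prems(2)] measurable_cong_sets[OF sets_eq refl] by blast
  define N where "N = {x \<in> space (Pi\<^sub>M (insert e E) D). f x = 0}"
  have N: "N \<in> sets (Pi\<^sub>M (insert e E) D)" unfolding N_def using meas by measurable
  have "emeasure (Pi\<^sub>M (insert e E) D) N = (\<integral>\<^sup>+x. indicator N x \<partial>Pi\<^sub>M (insert e E) D)"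
    using N by simp
  also have "\<dots> = (\<integral>\<^sup>+x. (\<integral>\<^sup>+z. indicator N (x(e := z)) \<partial>D e) \<partial>Pi\<^sub>M E D)"
    using N insert.hyps by (intro product_nn_integral_insert) auto
  also have "\<dots> = (\<integral>\<^sup>+x. 0 \<partial>Pi\<^sub>M E D)"
  proof (rule nn_integral_cong_AE, use IH in eventually_elim)
    case (elim x)
    have "(\<integral>\<^sup>+z. indicator N (x(e := z)) \<partial>D e) = (\<integral>\<^sup>+z. 0 \<partial>D e)"
      by (rule nn_integral_cong_AE, use inner[OF elim] in eventually_elim) (simp add: N_def)
    then show ?case by simp
  qed
  finally have "N \<in> null_sets (Pi\<^sub>M (insert e E) D)" using N by auto
  then show ?case by (rule AE_I') (auto simp: N_def)
qed

text \<open>Independence identifies the joint law with the product of the marginal laws, which moves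
  the claim to the product measure.\<close>

lemma (in prob_space) AE_polyfun_nonzero:
  fixes X :: "'e \<Rightarrow> 'a \<Rightarrow> complex"
  assumes E: "finite E" "E \<noteq> {}" and indep: "indep_vars (\<lambda>_. borel) X E"
    and atomless: "\<And>e z. e \<in> E \<Longrightarrow> measure (distr M borel (X e)) {z} = 0"
    and f: "polyfun E f" "f u \<noteq> 0"
  shows "AE \<omega> in M. f (\<lambda>e. X e \<omega>) \<noteq> 0"
proof -
  have rv: "random_variable borel (X e)" if "e \<in> E" for e
    using indep that by (auto simp: indep_vars_def)
  \<comment> \<open>The point mass outside \<open>E\<close> is a dummy value that makes every member
    of the family a probability measure.\<close>
  define D where "D e = (if e \<in> E then distr M borel (X e) else return borel 0)" for e
  have "prob_space (D e)" for e
    by (auto simp: D_def rv prob_space_distr prob_space_return)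
  moreover have "emeasure (D e) {z} = 0" if "e \<in> E" for e z
  proof -
    interpret De: prob_space "distr M borel (X e)" by (intro prob_space_distr rv that)
    show ?thesis using atomless[OF that] that by (simp add: D_def De.emeasure_eq_measure)
  qed
  ultimately have AE_D: "AE x in Pi\<^sub>M E D. f x \<noteq> 0"
    by (intro AE_PiM_polyfun_nonzero[of E D f u] E f) (auto simp: D_def)
  have distr_eq: "Pi\<^sub>M E D = distr M (Pi\<^sub>M E (\<lambda>_. borel)) (\<lambda>\<omega>. \<lambda>e\<in>E. X e \<omega>)"
    using indep indep_vars_iff_distr_eq_PiM'[OF E(2) rv, of "\<lambda>e. e"]
    by (auto simp: D_def intro!: PiM_cong)
  have X: "(\<lambda>\<omega>. \<lambda>e\<in>E. X e \<omega>) \<in> measurable M (Pi\<^sub>M E (\<lambda>_. borel))"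
    by (intro measurable_restrict rv)
  have S: "{x \<in> space (Pi\<^sub>M E (\<lambda>_. borel)). f x \<noteq> 0} \<in> sets (Pi\<^sub>M E (\<lambda>_. borel))"
    using polyfun_measurable[OF f(1)] by measurable
  have "AE \<omega> in M. f (\<lambda>e\<in>E. X e \<omega>) \<noteq> 0"
    using AE_D unfolding distr_eq AE_distr_iff[OF X S] .
  moreover have "f (\<lambda>e\<in>E. X e \<omega>) = f (\<lambda>e. X e \<omega>)" for \<omega>
    by (rule polyfun_cong[OF f(1)]) simp
  ultimately show ?thesis by simp
qed

section \<open>Matrices\<close>

text \<open>Full row rank means that the columns contain a basis, so every unit vector is a
  combination of columns; the coefficient vectors form \<open>W\<close>.\<close>

lemma full_row_rank_right_inverse:
  assumes A: "A \<in> carrier_mat n m" and rank: "full_row_rank A"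
  obtains W where "W \<in> carrier_mat m n" "A * W = 1\<^sub>m n"
proof -
  interpret vec_space "TYPE(complex)" n .
  have cols: "set (cols A) \<subseteq> carrier_vec n" using A cols_dim by blast
  have "lin_indpt {}" by (simp add: lin_dep_def)
  then obtain S where S: "finite S" "maximal S (\<lambda>T. T \<subseteq> set (cols A) \<and> lin_indpt T)"
    using maximal_exists_superset[of "set (cols A)" "\<lambda>T. T \<subseteq> set (cols A) \<and> lin_indpt T" "{}"] by auto
  then have sub: "S \<subseteq> set (cols A)" and li: "lin_indpt S" by (auto simp: maximal_def)
  have "card S = n"
    using rank_card_indpt[OF A S(2)] rank A by (simp add: full_row_rank_def mat_rank_def)
  then have "basis S"
    using S(1) sub li cols by (intro dim_li_is_basis) (auto simp: dim_is_n)
  then have "carrier_vec n \<subseteq> span (set (cols A))"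
    using span_is_monotone[OF sub] by (auto simp: basis_def)
  then have "\<exists>x\<in>carrier_vec m. A *\<^sub>v x = y" if "y \<in> carrier_vec n" for y
    using that col_space_eq[OF A] A by (auto simp: col_space_def)
  then obtain X where X: "\<And>y. y \<in> carrier_vec n \<Longrightarrow> X y \<in> carrier_vec m \<and> A *\<^sub>v X y = y" by metis
  define W where "W = mat_of_cols m (map (\<lambda>i. X (unit_vec n i)) [0..<n])"
  have W: "W \<in> carrier_mat m n" by (simp add: W_def mat_of_cols_carrier(1)[of m "map (\<lambda>i. X (unit_vec n i)) [0..<n]", simplified])
  have "A * W = 1\<^sub>m n"
  proof (rule mat_col_eqI)
    fix i assume "i < dim_col (1\<^sub>m n :: complex mat)"
    then have i: "i < n" by simp
    have "col W i = X (unit_vec n i)"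
      unfolding W_def using i X[of "unit_vec n i"] by (subst col_mat_of_cols) auto
    then show "col (A * W) i = col (1\<^sub>m n) i"
      using col_mult2[OF A W i] X[of "unit_vec n i"] i by simp
  qed (use A W in auto)
  then show ?thesis using W that by blast
qed

lemma det_nonzero_iff_full_row_rank:
  assumes "A \<in> carrier_mat n n" shows "det A \<noteq> 0 \<longleftrightarrow> full_row_rank A"
  using vec_space.det_rank_iff[OF assms] assms by (auto simp: full_row_rank_def mat_rank_def)

lemma polyfun_det:
  assumes "\<And>x. A x \<in> carrier_mat n n" "\<And>i j. i < n \<Longrightarrow> j < n \<Longrightarrow> polyfun V (\<lambda>x. A x $$ (i, j))"
  shows "polyfun V (\<lambda>x. det (A x))"
proof -
  have "polyfun V (\<lambda>x. \<Sum>p\<in>{p. p permutes {0..<n}}. signof p * (\<Prod>i = 0..<n. A x $$ (i, p i)))"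
    by (intro polyfun_sum polyfun.mult polyfun.const polyfun_prod assms(2)) (auto simp: permutes_in_image)
  then show ?thesis by (simp add: det_def'[OF assms(1)])
qed

lemma mat_adjoint_index:
  assumes "A \<in> carrier_mat n m" "i < m" "j < n"
  shows "mat_adjoint A $$ (i, j) = conjugate (A $$ (j, i))"
  using assms by (simp add: mat_adjoint_def mat_of_rows_def)

lemma mat_adjoint_carrier: "A \<in> carrier_mat n m \<Longrightarrow> mat_adjoint A \<in> carrier_mat m n"
  by (auto simp: mat_adjoint_def)

lemma sum_lessThan_split:
  fixes d n :: nat
  assumes "d \<le> n" shows "sum f {..<n} = sum f {..<d} + (\<Sum>i<n - d. f (d + i))"
proof -
  have "sum f {..<d + e} = sum f {..<d} + (\<Sum>i<e. f (d + i))" for e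
    by (induction e) (simp_all add: add.assoc)
  from this[of "n - d"] show ?thesis using assms by simp
qed

lemma triple_product_index:
  assumes "A \<in> carrier_mat a n" "B \<in> carrier_mat n m" "C \<in> carrier_mat m b" "i < a" "j < b"
  shows "(A * B * C) $$ (i, j) = (\<Sum>k<n. \<Sum>l<m. A $$ (i, k) * B $$ (k, l) * C $$ (l, j))"
  using assms by (simp add: scalar_prod_def atLeast0LessThan sum_distrib_left mult.assoc)

section \<open>The alignment equations\<close>

type_synonym unknown = "(nat \<times> nat \<times> nat) + (nat \<times> nat \<times> nat)"
type_synonym entry = "nat \<times> nat \<times> nat \<times> nat"

definition channel_entries :: "nat \<Rightarrow> (nat \<Rightarrow> nat) \<Rightarrow> (nat \<Rightarrow> nat) \<Rightarrow> entry set" where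
  "channel_entries K M N = {(k, j, p, q). k < K \<and> j < K \<and> p < N k \<and> q < M j}"

definition channel :: "(nat \<Rightarrow> nat) \<Rightarrow> (nat \<Rightarrow> nat) \<Rightarrow> (entry \<Rightarrow> complex) \<Rightarrow> nat \<Rightarrow> nat \<Rightarrow> complex mat" where
  "channel M N h k j = mat (N k) (M j) (\<lambda>(p, q). h (k, j, p, q))"

text \<open>\<open>rx\<close> gives the entries of \<open>U\<^sub>k\<^sup>H\<close> rather than \<open>U\<^sub>k\<close>, so that all equations are polynomial, without
  complex conjugation.\<close>

definition rx :: "(nat \<Rightarrow> nat) \<Rightarrow> (unknown \<Rightarrow> complex) \<Rightarrow> nat \<Rightarrow> nat \<Rightarrow> nat \<Rightarrow> complex" where
  "rx d x k p n = (if n < d k then if n = p then 1 else 0 else x (Inl (k, p, n - d k)))"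

definition tx :: "(nat \<Rightarrow> nat) \<Rightarrow> (unknown \<Rightarrow> complex) \<Rightarrow> nat \<Rightarrow> nat \<Rightarrow> nat \<Rightarrow> complex" where
  "tx d x j q m = (if m < d j then if m = q then 1 else 0 else x (Inr (j, q, m - d j)))"

text \<open>The \<open>(p, q)\<close> entry of \<open>U\<^sub>k\<^sup>H H\<^sub>k\<^sub>j V\<^sub>j\<close>.\<close>

definition filtered ::
  "(nat \<Rightarrow> nat) \<Rightarrow> (nat \<Rightarrow> nat) \<Rightarrow> (nat \<Rightarrow> nat) \<Rightarrow> (unknown \<Rightarrow> complex) \<Rightarrow> (entry \<Rightarrow> complex) \<Rightarrow> entry \<Rightarrow> complex"
  where "filtered M N d x h = (\<lambda>(k, j, p, q).
    \<Sum>n<N k. \<Sum>m<M j. rx d x k p n * h (k, j, n, m) * tx d x j q m)"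

definition linear_part ::
  "(nat \<Rightarrow> nat) \<Rightarrow> (nat \<Rightarrow> nat) \<Rightarrow> (nat \<Rightarrow> nat) \<Rightarrow> (unknown \<Rightarrow> complex) \<Rightarrow> (entry \<Rightarrow> complex) \<Rightarrow> entry \<Rightarrow> complex"
  where "linear_part M N d x h = (\<lambda>(k, j, p, q).
    (\<Sum>n<N k - d k. x (Inl (k, p, n)) * h (k, j, d k + n, q)) +
    (\<Sum>m<M j - d j. x (Inr (j, q, m)) * h (k, j, p, d j + m)))"

definition quadratic_part ::
  "(nat \<Rightarrow> nat) \<Rightarrow> (nat \<Rightarrow> nat) \<Rightarrow> (nat \<Rightarrow> nat) \<Rightarrow> (unknown \<Rightarrow> complex) \<Rightarrow> (entry \<Rightarrow> complex) \<Rightarrow> entry \<Rightarrow> complex"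
  where "quadratic_part M N d x h = (\<lambda>(k, j, p, q).
    \<Sum>n<N k - d k. \<Sum>m<M j - d j.
      x (Inl (k, p, n)) * x (Inr (j, q, m)) * h (k, j, d k + n, d j + m))"

text \<open>Both sums are split at the identity blocks: identity with identity gives the channel
  entry, identity with unknowns the linear part, unknowns with unknowns the quadratic part.\<close>

lemma filtered_expand:
  assumes "d k \<le> N k" "d j \<le> M j" "p < d k" "q < d j"
  shows "filtered M N d x h (k, j, p, q) =
    h (k, j, p, q) + linear_part M N d x h (k, j, p, q) + quadratic_part M N d x h (k, j, p, q)"
proof -
  have tx: "(\<Sum>m<M j. a m * tx d x j q m) = a q + (\<Sum>m<M j - d j. a (d j + m) * x (Inr (j, q, m)))" for a
    using assms(4) by (simp add: sum_lessThan_split[OF assms(2)] tx_def if_distrib[of "(*) _"] sum.delta cong: if_cong)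
  have rx: "(\<Sum>n<N k. rx d x k p n * a n) = a p + (\<Sum>n<N k - d k. x (Inl (k, p, n)) * a (d k + n))" for a
    using assms(3) by (simp add: sum_lessThan_split[OF assms(1)] rx_def if_distrib[of "\<lambda>u. u * _"] sum.delta cong: if_cong)
  have "filtered M N d x h (k, j, p, q) = (\<Sum>n<N k. rx d x k p n * (\<Sum>m<M j. h (k, j, n, m) * tx d x j q m))"
    by (simp add: filtered_def sum_distrib_left mult.assoc)
  then show ?thesis unfolding tx rx
    by (simp add: linear_part_def quadratic_part_def algebra_simps sum.distrib sum_distrib_left)
qed

section \<open>\<open>H_all\<close> as the matrix of the linear part\<close>

lemma set_H_all_rows:
  "set (H_all_rows K d) = {(k, j, p, q). k < K \<and> j < K \<and> k \<noteq> j \<and> p < d k \<and> q < d j}"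
  by (force simp: H_all_rows_def split: if_splits)

lemma mem_H_all_cols:
  "Inl (k, p, n) \<in> set (H_all_cols K M N d) \<longleftrightarrow> k < K \<and> p < d k \<and> n < N k - d k"
  "Inr (j, q, m) \<in> set (H_all_cols K M N d) \<longleftrightarrow> j < K \<and> q < d j \<and> m < M j - d j"
  by (force simp: H_all_cols_def)+

text \<open>In row \<open>(k, j, p, q)\<close> only the columns of the receive unknowns for
  \<open>(k, p)\<close> and of the precoder unknowns for \<open>(j, q)\<close> contribute.\<close>

lemma H_all_entry_sum:
  assumes "k < K" "j < K" "p < d k" "q < d j" "d k \<le> N k" "d j \<le> M j"
  shows "(\<Sum>c\<in>set (H_all_cols K M N d). H_all_entry d (channel M N h) (k, j, p, q) c * x c) =
         linear_part M N d x h (k, j, p, q)"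
proof -
  let ?f = "\<lambda>c. H_all_entry d (channel M N h) (k, j, p, q) c * x c"
  let ?A = "(\<lambda>n. Inl (k, p, n)) ` {..<N k - d k} :: unknown set"
  let ?B = "(\<lambda>m. Inr (j, q, m)) ` {..<M j - d j} :: unknown set"
  have "sum ?f (set (H_all_cols K M N d)) = sum ?f (?A \<union> ?B)"
  proof (intro sum.mono_neutral_right ballI)
    show "?A \<union> ?B \<subseteq> set (H_all_cols K M N d)" using assms by (auto simp: mem_H_all_cols)
  next
    fix c assume "c \<in> set (H_all_cols K M N d) - (?A \<union> ?B)"
    then show "?f c = 0"
      by (cases c) (auto simp: H_all_entry_def mem_H_all_cols)
  qed simp
  also have "\<dots> = sum ?f ?A + sum ?f ?B"
    by (rule sum.union_disjoint) auto
  also have "sum ?f ?A = (\<Sum>n<N k - d k. x (Inl (k, p, n)) * h (k, j, d k + n, q))"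
    using assms by (subst sum.reindex) (auto simp: inj_on_def H_all_entry_def channel_def intro!: sum.cong)
  also have "sum ?f ?B = (\<Sum>m<M j - d j. x (Inr (j, q, m)) * h (k, j, p, d j + m))"
    using assms by (subst sum.reindex) (auto simp: inj_on_def H_all_entry_def channel_def intro!: sum.cong)
  finally show ?thesis by (simp add: linear_part_def)
qed

lemma H_all_carrier:
  "H_all K M N d H \<in> carrier_mat (length (H_all_rows K d)) (length (H_all_cols K M N d))"
  by (simp add: H_all_def)

text \<open>This passes between the given channel matrices and \<open>channel\<close>, which are
  known to agree only at indices below \<open>K\<close>.\<close>

lemma H_all_cong:
  assumes "\<And>k j. k < K \<Longrightarrow> j < K \<Longrightarrow> H k j = H' k j"
  shows "H_all K M N d H = H_all K M N d H'"
proof -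
  have "H_all_entry d H r c = H_all_entry d H' r c" if "r \<in> set (H_all_rows K d)" for r c
    using that assms by (auto simp: set_H_all_rows H_all_entry_def split: sum.splits)
  then show ?thesis unfolding H_all_def by (intro cong_mat) auto
qed

lemma linear_part_surj:
  assumes d: "\<And>k. k < K \<Longrightarrow> d k \<le> N k \<and> d k \<le> M k"
    and W: "W \<in> carrier_mat (length (H_all_cols K M N d)) (length (H_all_rows K d))"
    and inv: "H_all K M N d (channel M N h) * W = 1\<^sub>m (length (H_all_rows K d))"
  shows "\<exists>x. \<forall>i\<in>set (H_all_rows K d). linear_part M N d x h i = y i"
proof -
  let ?R = "H_all_rows K d" and ?C = "H_all_cols K M N d" and ?A = "H_all K M N d (channel M N h)"
  define b where "b = vec (length ?R) (\<lambda>r. y (?R ! r))"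
  define v where "v = W *\<^sub>v b"
  have b: "b \<in> carrier_vec (length ?R)" by (simp add: b_def)
  have v: "v \<in> carrier_vec (length ?C)" using W b by (simp add: v_def)
  have Av: "?A *\<^sub>v v = b"
    unfolding v_def using assoc_mult_mat_vec[OF H_all_carrier[of K M N d "channel M N h"] W b] inv b by simp
  \<comment> \<open>Summing over all positions that carry the label \<open>c\<close> avoids an
    appeal to distinctness of the list of columns.\<close>
  define x where "x c = (\<Sum>i | i < length ?C \<and> ?C ! i = c. v $ i)" for c
  have "linear_part M N d x h i = y i" if i: "i \<in> set ?R" for i
  proof -
    obtain r where r: "r < length ?R" "?R ! r = i" using i by (auto simp: in_set_conv_nth)
    let ?e = "H_all_entry d (channel M N h) i"
    have "y i = (?A *\<^sub>v v) $ r" unfolding Av using r by (simp add: b_def)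
    also have "\<dots> = (\<Sum>l<length ?C. ?e (?C ! l) * v $ l)"
      using r v by (simp add: H_all_def scalar_prod_def atLeast0LessThan)
    also have "\<dots> = (\<Sum>c\<in>set ?C. \<Sum>l | l \<in> {..<length ?C} \<and> ?C ! l = c. ?e (?C ! l) * v $ l)"
      by (rule sum.group[symmetric]) auto
    also have "\<dots> = (\<Sum>c\<in>set ?C. ?e c * x c)"
      by (auto simp: x_def sum_distrib_left intro!: sum.cong)
    also have "\<dots> = linear_part M N d x h i"
    proof -
      obtain k j p q where "i = (k, j, p, q)" by (cases i)
      with i d show ?thesis by (auto simp: set_H_all_rows intro!: H_all_entry_sum)
    qed
    finally show ?thesis ..
  qed
  then show ?thesis by blast
qed

lemma polyfun_H_all_entry:
  assumes "i \<in> set (H_all_rows K d)" "c \<in> set (H_all_cols K M N d)"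
    and "\<And>k. k < K \<Longrightarrow> d k \<le> N k \<and> d k \<le> M k"
  shows "polyfun (channel_entries K M N) (\<lambda>h. H_all_entry d (channel M N h) i c)"
proof -
  obtain k j p q where i: "i = (k, j, p, q)" by (cases i)
  then have kj: "k < K" "j < K" "p < d k" "q < d j" using assms(1) by (auto simp: set_H_all_rows)
  then have dkj: "d k \<le> N k" "d j \<le> M j" using assms(3) by auto
  show ?thesis
  proof (cases c)
    case (Inl a)
    obtain k' p' n where a: "a = (k', p', n)" by (cases a)
    show ?thesis
    proof (cases "k' = k \<and> p' = p")
      case True
      then have "n < N k - d k" using assms(2) by (simp add: Inl a mem_H_all_cols)
      then have "polyfun (channel_entries K M N) (\<lambda>h. h (k, j, d k + n, q))"
        using kj dkj by (intro polyfun.var) (auto simp: channel_entries_def)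
      then show ?thesis using True \<open>n < N k - d k\<close> kj dkj
        by (simp add: i Inl a H_all_entry_def channel_def)
    qed (simp add: i Inl a H_all_entry_def polyfun.const cong: conj_cong)
  next
    case (Inr a)
    obtain j' q' m where a: "a = (j', q', m)" by (cases a)
    show ?thesis
    proof (cases "j' = j \<and> q' = q")
      case True
      then have "m < M j - d j" using assms(2) by (simp add: Inr a mem_H_all_cols)
      then have "polyfun (channel_entries K M N) (\<lambda>h. h (k, j, p, d j + m))"
        using kj dkj by (intro polyfun.var) (auto simp: channel_entries_def)
      then show ?thesis using True \<open>m < M j - d j\<close> kj dkj
        by (simp add: i Inr a H_all_entry_def channel_def)
    qed (simp add: i Inr a H_all_entry_def polyfun.const cong: conj_cong)
  qed
qed

text \<open>\<open>R\<close> may vanish at \<open>h\<^sub>0\<close>, but full row rank there spreads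
  to all channels outside the zero set of a nonzero polynomial. So some \<open>h\<close> has both a
  surjective linear part and \<open>R h \<noteq> 0\<close>, and the coefficients are frozen at this
  \<open>h\<close>.\<close>

lemma linear_quadratic_dominant:
  assumes d: "\<And>k. k < K \<Longrightarrow> d k \<le> N k \<and> d k \<le> M k"
    and full: "full_row_rank (H_all K M N d (channel M N h\<^sub>0))"
    and R: "polyfun (channel_entries K M N) R" "R h\<^sub>1 \<noteq> 0"
  shows "\<exists>x h. R (\<lambda>e. if e \<in> set (H_all_rows K d)
           then - linear_part M N d x h e - quadratic_part M N d x h e else h e) \<noteq> 0"
proof -
  let ?E = "channel_entries K M N" and ?I = "set (H_all_rows K d)"
  let ?r = "length (H_all_rows K d)" and ?c = "length (H_all_cols K M N d)"
  let ?A = "\<lambda>h. H_all K M N d (channel M N h)"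
  obtain W where W: "W \<in> carrier_mat ?c ?r" "?A h\<^sub>0 * W = 1\<^sub>m ?r"
    using full_row_rank_right_inverse[OF H_all_carrier full] by blast
  have carr: "?A h * W \<in> carrier_mat ?r ?r" for h using H_all_carrier W(1) by (rule mult_carrier_mat)
  \<comment> \<open>This polynomial in \<open>h\<close> is 1 at \<open>h\<^sub>0\<close>. Wherever
    it is nonzero, \<open>W\<close> times an inverse of \<open>?A h * W\<close> is a right inverse
    of \<open>?A h\<close>.\<close>
  have "polyfun ?E (\<lambda>h. det (?A h * W))"
  proof (rule polyfun_det[OF carr])
    fix i j assume "i < ?r" "j < ?r"
    then have "polyfun ?E (\<lambda>h. \<Sum>l<?c. H_all_entry d (channel M N h) (H_all_rows K d ! i) (H_all_cols K M N d ! l) * W $$ (l, j))"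
      using d by (intro polyfun_sum polyfun.mult polyfun.const polyfun_H_all_entry) auto
    then show "polyfun ?E (\<lambda>h. (?A h * W) $$ (i, j))"
      using W(1) \<open>i < ?r\<close> \<open>j < ?r\<close> by (simp add: H_all_def scalar_prod_def atLeast0LessThan)
  qed
  moreover have "det (?A h\<^sub>0 * W) \<noteq> 0" using W by simp
  ultimately obtain h where h: "R h \<noteq> 0" "det (?A h * W) \<noteq> 0"
    using polyfun_mult_nonzero[OF R(1) _ R(2)] by fastforce
  obtain W' where W': "W' \<in> carrier_mat ?r ?r" "?A h * W * W' = 1\<^sub>m ?r"
    using full_row_rank_right_inverse[OF carr] h(2) det_nonzero_iff_full_row_rank[OF carr] by blast
  have inv: "?A h * (W * W') = 1\<^sub>m ?r"
    using assoc_mult_mat[OF H_all_carrier[of K M N d "channel M N h"] W(1) W'(1)] W'(2) by simp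
  have "\<exists>x. \<forall>i\<in>?I. linear_part M N d x h i = - y i" for y
    by (rule linear_part_surj[OF d mult_carrier_mat[OF W(1) W'(1)] inv])
  then have surj: "\<exists>x. \<forall>i\<in>?I. - linear_part M N d x h i = y i" for y
    by (metis minus_minus)
  \<comment> \<open>\<open>R\<close> as a polynomial in the entries to be solved for, with all other
    entries fixed.\<close>
  define R' where "R' a = R (\<lambda>e. if e \<in> ?I then a e else h e)" for a
  have R': "polyfun ?I R'"
    unfolding R'_def using R(1)
  proof (rule polyfun_subst)
    show "polyfun ?I (\<lambda>a. if e \<in> ?I then a e else h e)" for e
      by (cases "e \<in> ?I") (auto intro: polyfun.intros)
  qed
  have "R' h \<noteq> 0" using h by (simp add: R'_def cong: if_cong)
  have "\<exists>x. R' (\<lambda>i. - linear_part M N d x h i + - quadratic_part M N d x h i) \<noteq> 0"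
  proof (rule polyfun_nonzero_on_linear_plus_quadratic_image[of ?I R' h, OF R' \<open>R' h \<noteq> 0\<close> _ _ surj])
    fix s x i
    show "- linear_part M N d (\<lambda>j. s * x j) h i = s * - linear_part M N d x h i"
      by (cases i) (simp add: linear_part_def sum_distrib_left algebra_simps)
    show "- quadratic_part M N d (\<lambda>j. s * x j) h i = s\<^sup>2 * - quadratic_part M N d x h i"
      by (cases i) (simp add: quadratic_part_def sum_distrib_left power2_eq_square algebra_simps)
  qed
  then show ?thesis unfolding R'_def by (auto cong: if_cong)
qed

lemma IA_solvable_channel:
  assumes d: "\<And>k. k < K \<Longrightarrow> d k \<le> N k \<and> d k \<le> M k"
    and H: "\<And>k j. k < K \<Longrightarrow> j < K \<Longrightarrow> H k j \<in> carrier_mat (N k) (M j)"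
    and h: "\<And>k j p q. k < K \<Longrightarrow> j < K \<Longrightarrow> p < N k \<Longrightarrow> q < M j \<Longrightarrow> h (k, j, p, q) = H k j $$ (p, q)"
    and zero: "\<And>i. i \<in> set (H_all_rows K d) \<Longrightarrow> filtered M N d x h i = 0"
    and det: "\<And>k. k < K \<Longrightarrow> det (mat (d k) (d k) (\<lambda>(p, q). filtered M N d x h (k, k, p, q))) \<noteq> 0"
  shows "IA_solvable K M N d H"
proof -
  \<comment> \<open>Conjugation here makes \<open>rx\<close> the entries of the adjoint.\<close>
  define U where "U k = mat (N k) (d k) (\<lambda>(n, p). cnj (rx d x k p n))" for k
  define V where "V j = mat (M j) (d j) (\<lambda>(m, q). tx d x j q m)" for j
  have U: "U k \<in> carrier_mat (N k) (d k)" for k by (simp add: U_def)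
  have V: "V k \<in> carrier_mat (M k) (d k)" for k by (simp add: V_def)
  have UHV: "mat_adjoint (U k) * H k j * V j = mat (d k) (d j) (\<lambda>(p, q). filtered M N d x h (k, j, p, q))"
    if kj: "k < K" "j < K" for k j
  proof (rule eq_matI)
    fix p q assume "p < dim_row (mat (d k) (d j) (\<lambda>(p, q). filtered M N d x h (k, j, p, q)))"
      "q < dim_col (mat (d k) (d j) (\<lambda>(p, q). filtered M N d x h (k, j, p, q)))"
    then have pq: "p < d k" "q < d j" by auto
    have "(mat_adjoint (U k) * H k j * V j) $$ (p, q) =
        (\<Sum>n<N k. \<Sum>m<M j. mat_adjoint (U k) $$ (p, n) * H k j $$ (n, m) * V j $$ (m, q))"
      by (rule triple_product_index[OF mat_adjoint_carrier[OF U] H[OF kj] V pq])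
    also have "\<dots> = filtered M N d x h (k, j, p, q)"
      using pq kj by (auto simp: filtered_def mat_adjoint_index[OF U] h intro!: sum.cong) (simp add: U_def V_def)
    finally show "(mat_adjoint (U k) * H k j * V j) $$ (p, q) =
        mat (d k) (d j) (\<lambda>(p, q). filtered M N d x h (k, j, p, q)) $$ (p, q)"
      using pq by simp
  qed (use mat_adjoint_carrier[OF U] V in auto)
  have "mat_rank (mat_adjoint (U k) * H k k * V k) = d k" if "k < K" for k
    using det_nonzero_iff_full_row_rank[of "mat_adjoint (U k) * H k k * V k" "d k"] det[OF that]
    by (simp add: UHV[OF that that] full_row_rank_def)
  moreover have "mat_adjoint (U k) * H k j * V j = 0\<^sub>m (d k) (d j)" if "k < K" "j < K" "k \<noteq> j" for k j
    unfolding UHV[OF that(1,2)] using that by (intro eq_matI) (auto simp: zero set_H_all_rows)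
  ultimately show ?thesis
    unfolding IA_solvable_def IA_solution_def using U V by blast
qed

text \<open>Each filtered cross entry is the corresponding channel entry plus an expression free of
  the entries indexed by the rows of \<open>H_all\<close>, so alignment has the solved form
  \<open>h i = g i x h\<close>.\<close>

lemma generic_alignment:
  assumes d: "\<And>k. k < K \<Longrightarrow> d k \<le> N k \<and> d k \<le> M k"
    and full: "full_row_rank (H_all K M N d (channel M N h\<^sub>0))"
  shows "\<exists>R. polyfun (channel_entries K M N) R \<and> (\<exists>h. R h \<noteq> 0) \<and> (\<forall>h. R h \<noteq> 0 \<longrightarrow>
    (\<exists>x. (\<forall>i\<in>set (H_all_rows K d). filtered M N d x h i = 0) \<and>
      (\<forall>k<K. det (mat (d k) (d k) (\<lambda>(p, q). filtered M N d x h (k, k, p, q))) \<noteq> 0)))"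
proof -
  let ?E = "channel_entries K M N" and ?I = "set (H_all_rows K d)" and ?J = "set (H_all_cols K M N d)"
  let ?V = "?J <+> (?E - ?I)"
  define g where "g i x h = - linear_part M N d x h i - quadratic_part M N d x h i" for i x h
  define D where "D x h = (\<Prod>k<K. det (mat (d k) (d k) (\<lambda>(p, q). filtered M N d x h (k, k, p, q))))" for x h
  \<comment> \<open>The coefficients in use belong to direct channels or lie outside the top blocks
    of cross channels, so they are not among the entries solved for.\<close>
  have mem: "(k, j, p, q) \<in> ?E - ?I" if "k < K" "j < K" "p < N k" "q < M j" "k = j \<or> d k \<le> p \<or> d j \<le> q" for k j p q
    using that by (auto simp: channel_entries_def set_H_all_rows)
  have sub: "?I \<subseteq> ?E" using d by (fastforce simp: channel_entries_def set_H_all_rows)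
  have var: "polyfun ?V (\<lambda>v. v (Inl c))" if "c \<in> ?J" for c using that by (intro polyfun.var) auto
  have par: "polyfun ?V (\<lambda>v. v (Inr e))" if "e \<in> ?E - ?I" for e using that by (intro polyfun.var) auto
  have lin: "polyfun ?V (\<lambda>v. linear_part M N d (v \<circ> Inl) (v \<circ> Inr) i)"
    and quad: "polyfun ?V (\<lambda>v. quadratic_part M N d (v \<circ> Inl) (v \<circ> Inr) i)"
    if i_eq: "i = (k, j, p, q)" and i: "k < K" "j < K" "p < d k" "q < d j" for i k j p q
  proof -
    have dkj: "d k \<le> N k" "d j \<le> M j" using i d by auto
    show "polyfun ?V (\<lambda>v. linear_part M N d (v \<circ> Inl) (v \<circ> Inr) i)"
      unfolding linear_part_def i_eq prod.case comp_def
      using i dkj by (intro polyfun_sum polyfun.add polyfun.mult var par mem) (auto simp: mem_H_all_cols)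
    show "polyfun ?V (\<lambda>v. quadratic_part M N d (v \<circ> Inl) (v \<circ> Inr) i)"
      unfolding quadratic_part_def i_eq prod.case comp_def
      using i dkj by (intro polyfun_sum polyfun.mult var par mem) (auto simp: mem_H_all_cols)
  qed
  have D: "polyfun ?V (\<lambda>v. D (v \<circ> Inl) (v \<circ> Inr))"
    unfolding D_def
  proof (intro polyfun_prod polyfun_det)
    fix k p q assume k: "k \<in> {..<K}" "p < d k" "q < d k"
    then have "d k \<le> N k" "d k \<le> M k" using d by auto
    with k show "polyfun ?V (\<lambda>v. mat (d k) (d k) (\<lambda>(p, q). filtered M N d (v \<circ> Inl) (v \<circ> Inr) (k, k, p, q)) $$ (p, q))"
      by (simp add: filtered_expand) (intro polyfun.add lin[OF refl] quad[OF refl] par mem; auto)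
  qed simp
  \<comment> \<open>With zero unknowns and ones on the diagonals, every filtered direct channel is
    an identity matrix, so \<open>D\<close> is nonzero at this point.\<close>
  define h\<^sub>1 :: "entry \<Rightarrow> complex" where "h\<^sub>1 = (\<lambda>(k, j, p, q). if p = q then 1 else 0)"
  have "mat (d k) (d k) (\<lambda>(p, q). filtered M N d (\<lambda>_. 0) h\<^sub>1 (k, k, p, q)) = 1\<^sub>m (d k)" if "k < K" for k
    using d[OF that] by (intro eq_matI) (auto simp: filtered_expand linear_part_def quadratic_part_def h\<^sub>1_def)
  then have D0: "D (\<lambda>_. 0) h\<^sub>1 \<noteq> 0" by (simp add: D_def)
  have g: "polyfun ?V (\<lambda>v. g i (v \<circ> Inl) (v \<circ> Inr))" if "i \<in> ?I" for i
  proof -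
    obtain k j p q where i: "i = (k, j, p, q)" by (cases i)
    show ?thesis unfolding g_def
      using that by (intro polyfun_diff polyfun_uminus lin[OF i] quad[OF i]) (auto simp: i set_H_all_rows)
  qed
  have dom: "\<exists>x h. R (\<lambda>e. if e \<in> ?I then g e x h else h e) \<noteq> 0" if "polyfun ?E R" "R h \<noteq> 0" for R h
    unfolding g_def by (rule linear_quadratic_dominant[OF d full that])
  have "\<exists>R. polyfun ?E R \<and> (\<exists>h. R h \<noteq> 0) \<and>
    (\<forall>h. R h \<noteq> 0 \<longrightarrow> (\<exists>x. (\<forall>i\<in>?I. h i = g i x h) \<and> D x h \<noteq> 0))"
    by (rule generic_solvability[of ?I ?E ?J g D "\<lambda>_. 0" h\<^sub>1]) (fact sub finite_set g D D0 dom)+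
  then obtain R where "polyfun ?E R \<and> (\<exists>h. R h \<noteq> 0) \<and>
    (\<forall>h. R h \<noteq> 0 \<longrightarrow> (\<exists>x. (\<forall>i\<in>?I. h i = g i x h) \<and> D x h \<noteq> 0))" ..
  note R = this[THEN conjunct1] this[THEN conjunct2, THEN conjunct1] this[THEN conjunct2, THEN conjunct2]
  have "\<exists>x. (\<forall>i\<in>?I. filtered M N d x h i = 0) \<and>
      (\<forall>k<K. det (mat (d k) (d k) (\<lambda>(p, q). filtered M N d x h (k, k, p, q))) \<noteq> 0)" if Rh: "R h \<noteq> 0" for h
  proof -
    obtain x where x: "\<forall>i\<in>?I. h i = g i x h" "D x h \<noteq> 0" using R(3) Rh by blast
    have "filtered M N d x h i = 0" if "i \<in> ?I" for i
    proof -
      obtain k j p q where i: "i = (k, j, p, q)" by (cases i)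
      with that have "filtered M N d x h i = h i + linear_part M N d x h i + quadratic_part M N d x h i"
        using d by (auto simp: set_H_all_rows intro!: filtered_expand)
      then show ?thesis using x(1) that by (simp add: g_def)
    qed
    with x(2) show ?thesis by (intro exI[of _ x]) (auto simp: D_def)
  qed
  with R(1,2) show ?thesis by blast
qed

theorem mainTheorem2:
  fixes \<Omega> :: "'w measure"
    and K :: nat
    and M N d :: "nat \<Rightarrow> nat"
    and H :: "nat \<Rightarrow> nat \<Rightarrow> 'w \<Rightarrow> complex mat"
  assumes "prob_space \<Omega>"
    and "0 < K"
    and "\<And>k. k < K \<Longrightarrow> 0 < M k \<and> 0 < N k \<and> 0 < d k"
    and "\<And>k. k < K \<Longrightarrow> d k \<le> min (M k) (N k)"
    and "\<And>k j \<omega>. k < K \<Longrightarrow> j < K \<Longrightarrow> \<omega> \<in> space \<Omega> \<Longrightarrow> H k j \<omega> \<in> carrier_mat (N k) (M j)"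
    and "prob_space.indep_vars \<Omega> (\<lambda>_. borel) (\<lambda>(k, j, p, q) \<omega>. H k j \<omega> $$ (p, q))
           {(k, j, p, q). k < K \<and> j < K \<and> p < N k \<and> q < M j}"
    and "\<And>k j p q. k < K \<Longrightarrow> j < K \<Longrightarrow> p < N k \<Longrightarrow> q < M j \<Longrightarrow>
           continuous_distribution (distr \<Omega> borel (\<lambda>\<omega>. H k j \<omega> $$ (p, q)))"
  shows "AE \<omega> in \<Omega>. full_row_rank (H_all K M N d (\<lambda>k j. H k j \<omega>)) \<longrightarrow>
           IA_solvable K M N d (\<lambda>k j. H k j \<omega>)"
proof (cases "\<exists>\<omega>\<in>space \<Omega>. full_row_rank (H_all K M N d (\<lambda>k j. H k j \<omega>))")
  case False
  then show ?thesis by (intro AE_I2) blast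
next
  case True
  \<comment> \<open>A single outcome of full row rank suffices: it yields a nonzero polynomial
    \<open>R\<close>, which is then almost surely nonzero on the whole space. Without such an
    outcome the implication is vacuous.\<close>
  then obtain \<omega>\<^sub>0 where \<omega>\<^sub>0: "\<omega>\<^sub>0 \<in> space \<Omega>" "full_row_rank (H_all K M N d (\<lambda>k j. H k j \<omega>\<^sub>0))" by blast
  interpret prob_space \<Omega> by fact
  have d: "d k \<le> N k \<and> d k \<le> M k" if "k < K" for k using assms(4)[OF that] by simp
  define X where "X = (\<lambda>(k, j, p, q) \<omega>. H k j \<omega> $$ (p, q))"
  let ?E = "channel_entries K M N"
  have "channel M N (\<lambda>e. X e \<omega>\<^sub>0) k j = H k j \<omega>\<^sub>0" if "k < K" "j < K" for k j
    using assms(5)[OF that \<omega>\<^sub>0(1)] by (intro eq_matI) (auto simp: channel_def X_def)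
  then have "full_row_rank (H_all K M N d (channel M N (\<lambda>e. X e \<omega>\<^sub>0)))"
    using \<omega>\<^sub>0(2) H_all_cong[of K "channel M N (\<lambda>e. X e \<omega>\<^sub>0)" "\<lambda>k j. H k j \<omega>\<^sub>0"] by simp
  then obtain R u where R: "polyfun ?E R" "R u \<noteq> 0" and solve: "\<forall>h. R h \<noteq> 0 \<longrightarrow>
    (\<exists>x. (\<forall>i\<in>set (H_all_rows K d). filtered M N d x h i = 0) \<and>
      (\<forall>k<K. det (mat (d k) (d k) (\<lambda>(p, q). filtered M N d x h (k, k, p, q))) \<noteq> 0))"
    using generic_alignment[of K d N M, OF d] by blast
  have "?E \<subseteq> {..<K} \<times> {..<K} \<times> (\<Union>k<K. {..<N k}) \<times> (\<Union>k<K. {..<M k})"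
    by (auto simp: channel_entries_def)
  then have "finite ?E" by (rule finite_subset) auto
  \<comment> \<open>The characterisation of independence by product measures asks for a nonempty
    index set; positivity of \<open>K\<close> and of the antenna numbers provides one.\<close>
  moreover have "(0, 0, 0, 0) \<in> ?E" using assms(2,3) by (simp add: channel_entries_def)
  then have "?E \<noteq> {}" by blast
  moreover have "indep_vars (\<lambda>_. borel) X ?E"
    using assms(6) by (simp add: X_def channel_entries_def)
  moreover have "measure (distr \<Omega> borel (X e)) {z} = 0" if "e \<in> ?E" for e z
    using that assms(7) by (auto simp: channel_entries_def X_def continuous_distribution_def)
  ultimately have "AE \<omega> in \<Omega>. R (\<lambda>e. X e \<omega>) \<noteq> 0"
    by (intro AE_polyfun_nonzero[of ?E X R u] R)
  then show ?thesis
  proof (rule AE_mp, intro AE_I2 impI)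
    fix \<omega> assume \<omega>: "\<omega> \<in> space \<Omega>" "R (\<lambda>e. X e \<omega>) \<noteq> 0"
    then obtain x where x: "\<And>i. i \<in> set (H_all_rows K d) \<Longrightarrow> filtered M N d x (\<lambda>e. X e \<omega>) i = 0"
      "\<And>k. k < K \<Longrightarrow> det (mat (d k) (d k) (\<lambda>(p, q). filtered M N d x (\<lambda>e. X e \<omega>) (k, k, p, q))) \<noteq> 0"
      using solve by blast
    show "IA_solvable K M N d (\<lambda>k j. H k j \<omega>)"
      by (rule IA_solvable_channel[OF d _ _ x]) (use assms(5) \<omega> in \<open>auto simp: X_def\<close>)
  qed
qed

end
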